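(* Suppose that $n$ points in $\mathbb{R}^m$ are generated according to the stochastic sphere model with two clusters $\Gamma_1,\Gamma_2$, $|\Gamma_1|\le|\Gamma_2|$, whose sphere centers are at distance $\Delta$, and let $r_1=\frac{2|\Gamma_1|}{|\Gamma_1|+|\Gamma_2|}$. If $$\Delta>\Delta_0:=1+\sqrt{1+\frac{2}{r_1}},$$ then the linear program (LP2) recovers the planted clusters with high probability.
   Context: Stochastic sphere model (SSM) with two clusters: there are two spheres $\partial\mathcal{B}_1,\partial\mathcal{B}_2\subset\mathbb{R}^m$ of unit radius (boundaries of unit balls) whose centers are at distance $\Delta$. The index set $[n]=\{1,\dots,n\}$ is partitioned into $\Gamma_1,\Gamma_2$ (the planted clusters, possibly of different sizes, $|\Gamma_1|\le|\Gamma_2|$), and the points $x^i$, $i\in[n]$, are drawn independently, $x^i$ being uniformly distributed on $\partial\mathcal{B}_l$ when $i\in\Gamma_l$, $l\in\{1,2\}$. The quantities $m$, $\Delta$ and $r_1\in(0,1]$ are fixed as $n\to\infty$ (so $|\Gamma_1|=r_1n/2$ and $|\Gamma_2|=(2-r_1)n/2$). "With high probability" means with probability tending to one as $n\to\infty$. With $d_{ij}=\|x^i-x^j\|_2^2$, (LP2) is the linear program in the entries of a symmetric matrix $X\in\mathbb{R}^{n\times n}$ ($X_{ij}=X_{ji}$): minimize $\sum_{i,j\in[n]}d_{ij}X_{ij}$ subject to $\mathrm{Tr}(X)=2$; $\sum_{j=1}^nX_{ij}=1$ for all $i\in[n]$; $X_{ij}+X_{ik}\le X_{ii}+X_{jk}$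 for all pairwise distinct $i,j,k\in[n]$ with $j<k$; $X_{ij}\ge0$ for all $1\le i<j\le n$. (LP2) recovers the planted clusters if its unique optimal solution is $\frac{1}{|\Gamma_1|}\mathbf{1}_{\Gamma_1}\mathbf{1}_{\Gamma_1}^T+\frac{1}{|\Gamma_2|}\mathbf{1}_{\Gamma_2}\mathbf{1}_{\Gamma_2}^T$, where $\mathbf{1}_\Gamma\in\mathbb{R}^n$ is the indicator vector of $\Gamma$. *)

theory Defs
  imports "HOL-Probability.Probability"
begin

text \<open>
  The uniform distribution on the unit sphere with centre \<open>c\<close>, i.e. the normalised surface
  measure: a set of directions is weighted by the normalised volume of the cone over it in the unit
  ball. The origin, which has no direction, is a null set. The lemmas
  \<open>prob_space_uniform_sphere\<close>, \<open>AE_uniform_sphere\<close> and \<open>uniform_sphere_rotation_invariant\<close> show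
  that this is the rotation-invariant probability measure on the sphere (the last one is stated for
  well-ordered index types because the library's result on volumes of orthogonal images is).
\<close>

definition uniform_sphere :: "real ^ 'm \<Rightarrow> (real ^ 'm) measure" where
  "uniform_sphere c = distr (uniform_measure lborel (ball 0 1)) borel (\<lambda>y. c + sgn y)"

lemma sets_uniform_sphere [measurable_cong, simp]: "sets (uniform_sphere c) = sets borel"
  by (simp add: uniform_sphere_def)

lemma measurable_shift_sgn [measurable]:
  "(\<lambda>y. c + sgn y) \<in> borel_measurable (borel :: (real ^ 'm) measure)"
  unfolding sgn_div_norm by measurable

lemma emeasure_unit_ball:
  "emeasure lborel (ball (0 :: real ^ 'm) 1) \<noteq> 0"
  "emeasure lborel (ball (0 :: real ^ 'm) 1) \<noteq> \<infinity>"
proof -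
  show "emeasure lborel (ball (0 :: real ^ 'm) 1) \<noteq> \<infinity>"
    using emeasure_lborel_ball_finite[of "0 :: real ^ 'm" 1] by simp
  have "0 < measure lborel (ball (0 :: real ^ 'm) 1)" by (intro content_ball_pos) simp
  then show "emeasure lborel (ball (0 :: real ^ 'm) 1) \<noteq> 0"
    by (auto simp: measure_def)
qed

lemma prob_space_uniform_sphere: "prob_space (uniform_sphere c)"
  unfolding uniform_sphere_def
  by (intro prob_space.prob_space_distr prob_space_uniform_measure emeasure_unit_ball) simp

lemma AE_uniform_sphere: "AE x in uniform_sphere c. x \<in> sphere c 1"
proof -
  have "AE y in lborel. y \<noteq> (0 :: real ^ 'm)"
    by (rule AE_lborel_singleton)
  then have "AE y in uniform_measure lborel (ball 0 1). c + sgn y \<in> sphere c 1"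
    by (intro AE_uniform_measureI) (auto simp: dist_norm norm_sgn elim!: eventually_mono)
  then show ?thesis
    unfolding uniform_sphere_def by (subst AE_distr_iff) auto
qed

lemma uniform_sphere_rotation_invariant:
  fixes c :: "real ^ 'm :: {finite, wellorder}"
  assumes T: "orthogonal_transformation T"
  shows "distr (uniform_sphere c) borel (\<lambda>x. c + T (x - c)) = uniform_sphere c"
proof (rule measure_eqI)
  have lin: "linear T" using T by (rule orthogonal_transformation_linear)
  have [measurable]: "T \<in> borel_measurable borel"
    using lin by (intro borel_measurable_continuous_onI linear_continuous_on linear_conv_bounded_linear[THEN iffD1])
  have sgnT: "sgn (T y) = T (sgn y)" for y
    using T by (simp add: sgn_div_norm orthogonal_transformation_norm linear_scale[OF lin])
  fix A assume "A \<in> sets (distr (uniform_sphere c) borel (\<lambda>x. c + T (x - c)))"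
  then have A [measurable]: "A \<in> sets borel" by simp
  define S where "S = ball 0 1 \<inter> (\<lambda>y. c + sgn y) -` A"
  define S' where "S' = ball 0 1 \<inter> (\<lambda>y. c + T (sgn y)) -` A"
  have [measurable]: "(\<lambda>y. c + T (sgn y)) \<in> borel_measurable borel"
    unfolding sgnT[symmetric] by measurable
  have mS [measurable]: "S \<in> sets borel" "S' \<in> sets borel"
    unfolding S_def S'_def using measurable_sets[OF _ A, of "\<lambda>y. c + sgn y" borel]
      measurable_sets[OF _ A, of "\<lambda>y. c + T (sgn y)" borel] by auto
  have img: "T ` S' = S"
  proof (intro equalityI subsetI)
    fix z assume "z \<in> S"
    moreover obtain y where "z = T y"
      using orthogonal_transformation_surj[OF T] by (metis surjD)
    ultimately show "z \<in> T ` S'"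
      using T by (auto simp: S_def S'_def orthogonal_transformation_norm sgnT)
  qed (use T in \<open>auto simp: S_def S'_def orthogonal_transformation_norm sgnT\<close>)
  have fin: "S \<in> lmeasurable" "S' \<in> lmeasurable"
    using mS by (auto simp: S_def S'_def intro!: bounded_set_imp_lmeasurable bounded_Int)
  have "measure lebesgue S = measure lebesgue S'"
    using measure_orthogonal_image[OF T fin(2)] img by simp
  then have "emeasure lebesgue S = emeasure lebesgue S'"
    using fin by (simp add: emeasure_eq_measure2)
  then have eq: "emeasure lborel S = emeasure lborel S'"
    using mS by (simp add: emeasure_completion)
  have "emeasure (uniform_sphere c) A = emeasure lborel S / emeasure lborel (ball (0 :: (real, 'm) vec) 1)"
    using measurable_sets[OF _ A, of "\<lambda>y. c + sgn y" borel]
    by (simp add: uniform_sphere_def emeasure_distr S_def)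
  moreover have "emeasure (distr (uniform_sphere c) borel (\<lambda>x. c + T (x - c))) A
      = emeasure lborel S' / emeasure lborel (ball (0 :: (real, 'm) vec) 1)"
    using measurable_sets[OF _ A, of "\<lambda>y. c + T (sgn y)" borel]
    by (simp add: uniform_sphere_def distr_distr comp_def emeasure_distr S'_def)
  ultimately show "emeasure (distr (uniform_sphere c) borel (\<lambda>x. c + T (x - c))) A
      = emeasure (uniform_sphere c) A"
    using eq by simp
qed simp

definition planted_partition :: "nat \<Rightarrow> nat set \<Rightarrow> nat set \<Rightarrow> bool" where
  "planted_partition n \<Gamma>1 \<Gamma>2 \<longleftrightarrow>
     \<Gamma>1 \<union> \<Gamma>2 = {1..n} \<and> \<Gamma>1 \<inter> \<Gamma>2 = {} \<and> \<Gamma>1 \<noteq> {} \<and> \<Gamma>2 \<noteq> {}"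

text \<open>The joint law of the points; \<open>c1\<close> and \<open>c2\<close> are the centres of the two spheres.\<close>

definition stochastic_sphere_model ::
  "real ^ 'm \<Rightarrow> real ^ 'm \<Rightarrow> nat set \<Rightarrow> nat set \<Rightarrow> (nat \<Rightarrow> real ^ 'm) measure" where
  "stochastic_sphere_model c1 c2 \<Gamma>1 \<Gamma>2 =
     (\<Pi>\<^sub>M i\<in>\<Gamma>1 \<union> \<Gamma>2. uniform_sphere (if i \<in> \<Gamma>1 then c1 else c2))"

text \<open>An \<open>n \<times> n\<close> matrix is a function of type \<open>nat \<Rightarrow> nat \<Rightarrow> real\<close>, of which only the entries
  with both indices in \<open>{1..n}\<close> are relevant.\<close>

definition lp2_feasible :: "nat \<Rightarrow> (nat \<Rightarrow> nat \<Rightarrow> real) \<Rightarrow> bool" where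
  "lp2_feasible n X \<longleftrightarrow>
     (\<forall>i\<in>{1..n}. \<forall>j\<in>{1..n}. X i j = X j i) \<and>
     (\<Sum>i=1..n. X i i) = 2 \<and>
     (\<forall>i\<in>{1..n}. (\<Sum>j=1..n. X i j) = 1) \<and>
     (\<forall>i\<in>{1..n}. \<forall>j\<in>{1..n}. \<forall>k\<in>{1..n}. i \<noteq> j \<and> i \<noteq> k \<and> j < k \<longrightarrow>
        X i j + X i k \<le> X i i + X j k) \<and>
     (\<forall>i\<in>{1..n}. \<forall>j\<in>{1..n}. i < j \<longrightarrow> X i j \<ge> 0)"

definition lp2_objective ::
  "nat \<Rightarrow> (nat \<Rightarrow> real ^ 'm) \<Rightarrow> (nat \<Rightarrow> nat \<Rightarrow> real) \<Rightarrow> real" where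
  "lp2_objective n x X = (\<Sum>i=1..n. \<Sum>j=1..n. (norm (x i - x j))\<^sup>2 * X i j)"

definition lp2_optimal ::
  "nat \<Rightarrow> (nat \<Rightarrow> real ^ 'm) \<Rightarrow> (nat \<Rightarrow> nat \<Rightarrow> real) \<Rightarrow> bool" where
  "lp2_optimal n x X \<longleftrightarrow>
     lp2_feasible n X \<and> (\<forall>Y. lp2_feasible n Y \<longrightarrow> lp2_objective n x X \<le> lp2_objective n x Y)"

definition planted_matrix :: "nat set \<Rightarrow> nat set \<Rightarrow> nat \<Rightarrow> nat \<Rightarrow> real" where
  "planted_matrix \<Gamma>1 \<Gamma>2 i j =
     1 / real (card \<Gamma>1) * (indicator \<Gamma>1 i * indicator \<Gamma>1 j) +
     1 / real (card \<Gamma>2) * (indicator \<Gamma>2 i * indicator \<Gamma>2 j)"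

definition lp2_recovers ::
  "nat \<Rightarrow> nat set \<Rightarrow> nat set \<Rightarrow> (nat \<Rightarrow> real ^ 'm) \<Rightarrow> bool" where
  "lp2_recovers n \<Gamma>1 \<Gamma>2 x \<longleftrightarrow>
     lp2_optimal n x (planted_matrix \<Gamma>1 \<Gamma>2) \<and>
     (\<forall>Y. lp2_optimal n x Y \<longrightarrow> (\<forall>i\<in>{1..n}. \<forall>j\<in>{1..n}. Y i j = planted_matrix \<Gamma>1 \<Gamma>2 i j))"

end

theory Submission
  imports Defs
begin

text \<open>
  Let \<open>a \<le> b\<close> be the sizes of the two clusters and \<open>\<rho> = b / a\<close>, so that \<open>2 / r1 = 1 + \<rho>\<close> and the
  threshold is \<open>\<Delta>0 = 1 + s\<close> with \<open>s = sqrt (2 + \<rho>)\<close>.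

  The deterministic part is linear programming duality. The triangle inequalities that are tight
  at the planted matrix are those with all three indices in one cluster and those whose apex and
  one leg lie in the same cluster. Weights on them are manufactured from the distances within the
  clusters (\<open>intra_inequality\<close>) and from two nonnegative arrays \<open>V i k\<close> and \<open>W i k\<close>, with \<open>i\<close> in
  the first and \<open>k\<close> in the second cluster (\<open>cut_inequality\<close>). The first array redistributes the
  cost \<open>d i k\<close> among the \<open>i\<close>, the second one among the \<open>k\<close>. The excess cost of a feasible \<open>Y\<close> over
  the planted matrix is then at least a weighted sum of the entries \<open>Y i k\<close> between the clusters.
  If all these weights are positive, an optimal \<open>Y\<close> has no mass between the clusters, and then it is
  the planted matrix (\<open>lp2_recovers_if_certificate\<close>).

  To find the arrays, write a point of the first cluster as its centre plus a unit vector \<open>y\<close>, a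
  point of the second cluster as its centre plus a unit vector \<open>z\<close>, and let \<open>e\<close> be the unit vector
  from the first centre to the second. For large samples the two clusters behave like the uniform
  distributions. In this limit, the requirement that all weights vanish at \<open>\<Delta> = \<Delta>0\<close> leaves only the
  choice of two functions \<open>\<phi> z\<close> and \<open>\<psi> y\<close> of mean zero, taken odd here, and of a kernel \<open>U y z\<close> whose
  averages over \<open>y\<close> and over \<open>z\<close> vanish. With \<open>D = 4 / (s - 1)\<close>, and up to additive constants that are
  given at \<open>recovers_if_kernel\<close>, the arrays are
  \<open>V = \<rho> * (D * (1 - y \<bullet> e) + U y z + \<phi> z)\<close> and
  \<open>W = D * (1 + z \<bullet> e) + (\<psi> y - 4 * (y \<bullet> z) - U y z) / \<rho>\<close>. Since the squared distance between two
  points of different clusters increases with \<open>\<Delta>\<close>, by an amount that is bounded below on the spheres,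
  the weights become positive for \<open>\<Delta> > \<Delta>0\<close>, with room for sampling errors. What remains is that \<open>V\<close>
  and \<open>W\<close> are nonnegative, a question about functions on the sphere, which \<open>exists_kernel\<close> answers;
  it is there that \<open>\<rho> \<ge> 1\<close> enters essentially, in the form \<open>D\<^sup>2 \<le> 4 * D + 8\<close>.

  The kernel is a finite sum of products of a bounded odd function of \<open>y\<close> and a bounded odd function
  of \<open>z\<close>. The uniform distribution on a sphere is invariant under the antipodal map, so odd functions
  have mean zero, and by Hoeffding's inequality the finitely many sample averages that occur are small
  with high probability. Finally, the event of recovery is measurable because the feasible matrices
  can be taken from a compact set (\<open>sets_lp2_recovers\<close>).
\<close>

section \<open>Averages over a finite set\<close>

definition avg :: "'a set \<Rightarrow> ('a \<Rightarrow> real) \<Rightarrow> real" where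
  "avg S f = (\<Sum>i\<in>S. f i) / real (card S)"

lemma avg_add: "avg S (\<lambda>i. f i + g i) = avg S f + avg S g"
  by (simp add: avg_def sum.distrib add_divide_distrib)

lemma avg_diff: "avg S (\<lambda>i. f i - g i) = avg S f - avg S g"
  by (simp add: avg_def sum_subtractf diff_divide_distrib)

lemma avg_cmult: "avg S (\<lambda>i. c * f i) = c * avg S f"
  by (simp add: avg_def sum_distrib_left)

lemma avg_multc: "avg S (\<lambda>i. f i * c) = avg S f * c"
  by (simp add: avg_def sum_distrib_right)

lemma avg_const: "finite S \<Longrightarrow> S \<noteq> {} \<Longrightarrow> avg S (\<lambda>i. c) = c"
  by (simp add: avg_def)

lemma avg_cong: "(\<And>i. i \<in> S \<Longrightarrow> f i = g i) \<Longrightarrow> avg S f = avg S g"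
  unfolding avg_def by (metis sum.cong)

lemma avg_swap: "avg S (\<lambda>i. avg K (f i)) = avg K (\<lambda>k. avg S (\<lambda>i. f i k))"
  unfolding avg_def sum_divide_distrib[symmetric] by (subst sum.swap) simp

lemma abs_avg_le:
  assumes "\<And>i. i \<in> S \<Longrightarrow> \<bar>f i\<bar> \<le> c" "0 \<le> c"
  shows "\<bar>avg S f\<bar> \<le> c"
proof (cases "card S = 0")
  case False
  have "\<bar>sum f S\<bar> \<le> (\<Sum>i\<in>S. \<bar>f i\<bar>)" by (rule sum_abs)
  also have "\<dots> \<le> real (card S) * c" using assms by (intro sum_bounded_above) auto
  finally show ?thesis using False by (simp add: avg_def field_simps)
qed (simp add: avg_def assms)

lemma sum_avg_swap: "(\<Sum>i\<in>S. avg K (f i)) = (\<Sum>k\<in>K. (\<Sum>i\<in>S. f i k)) / real (card K)"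
  unfolding avg_def sum_divide_distrib[symmetric] by (subst sum.swap) simp

section \<open>A dual certificate for the linear program\<close>

lemma lp2_feasible_sym:
  assumes "lp2_feasible n Y" "i \<in> {1..n}" "j \<in> {1..n}"
  shows "Y i j = Y j i"
  using assms unfolding lp2_feasible_def by blast

lemma lp2_feasible_nonneg:
  assumes "lp2_feasible n Y" "i \<in> {1..n}" "j \<in> {1..n}" "i \<noteq> j"
  shows "0 \<le> Y i j"
proof -
  have pos: "0 \<le> Y p q" if "p \<in> {1..n}" "q \<in> {1..n}" "p < q" for p q
    using assms(1) that unfolding lp2_feasible_def by blast
  show ?thesis
    using pos[of i j] pos[of j i] lp2_feasible_sym[OF assms(1-3)] assms(2-4)
    by (cases i j rule: linorder_cases) auto
qed

text \<open>
  The triangle inequality persists when indices coincide: the sum of the instances with apexes \<open>i\<close>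
  and \<open>j\<close> and a common third index \<open>l\<close> is \<open>2 * Y i j \<le> Y i i + Y j j\<close>. Sums over all triples can
  therefore be formed without excluding degenerate ones, which makes the averages below exact.
\<close>

lemma lp2_feasible_triangle:
  assumes feas: "lp2_feasible n Y" and n: "3 \<le> n"
    and i: "i \<in> {1..n}" and j: "j \<in> {1..n}" and k: "k \<in> {1..n}"
  shows "Y i j + Y i k \<le> Y i i + Y j k"
proof -
  note sym = lp2_feasible_sym[OF feas]
  have tri: "Y p q + Y p r \<le> Y p p + Y q r"
    if "p \<in> {1..n}" "q \<in> {1..n}" "r \<in> {1..n}" "p \<noteq> q" "p \<noteq> r" "q \<noteq> r" for p q r
  proof (cases "q < r")
    case True
    then show ?thesis using feas that unfolding lp2_feasible_def by blast
  next
    case False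
    then have "r < q" using that by simp
    then have "Y p r + Y p q \<le> Y p p + Y r q" 
      using feas that unfolding lp2_feasible_def by blast
    then show ?thesis using sym[OF that(2,3)] by simp
  qed
  have "Y i j + Y i j \<le> Y i i + Y j j" if "i \<noteq> j"
  proof -
    have "card {i, j} < card {1..n}" using n by (simp add: card_insert_if)
    then have "\<not> {1..n} \<subseteq> {i, j}" by (meson card_mono finite.emptyI finite.insertI leD)
    then obtain l where l: "l \<in> {1..n}" "l \<noteq> i" "l \<noteq> j" by blast
    then show ?thesis
      using tri[OF i j l(1)] tri[OF j i l(1)] that sym[OF i j] by simp
  qed
  then show ?thesis
    using tri[OF i j k] sym[OF i j] sym[OF i k] by (cases "i = j"; cases "i = k"; cases "j = k") auto
qed

lemma swap_sum: "(\<Sum>i\<in>S. \<Sum>j\<in>S. f i j) = (\<Sum>i\<in>S. \<Sum>j\<in>S. f j i)"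
  by (rule sum.swap)

text \<open>
  If \<open>H\<close> is the indicator of \<open>A \<subseteq> S\<close>, this is the sum of the triangle inequalities with apex in
  \<open>S - A\<close>, one leg in \<open>A\<close> and the other one an outer index whose column is \<open>y\<close>, and of
  \<open>2 * Y i j \<le> Y i i + Y j j\<close> over \<open>i, j \<in> A\<close>. A general \<open>H\<close> is the superposition of the indicators of
  its superlevel sets: the pair \<open>i, j\<close> is separated with total weight \<open>max (H j - H i) 0\<close> and lies
  above the level with total weight \<open>min (H i) (H j)\<close>.
\<close>

lemma cut_inequality:
  fixes Y :: "'a \<Rightarrow> 'a \<Rightarrow> real" and H y :: "'a \<Rightarrow> real"
  assumes H: "\<And>j. j \<in> S \<Longrightarrow> 0 \<le> H j"
    and tri: "\<And>i j. i \<in> S \<Longrightarrow> j \<in> S \<Longrightarrow> Y i j + y i \<le> Y i i + y j"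
    and diag: "\<And>i j. i \<in> S \<Longrightarrow> j \<in> S \<Longrightarrow> Y i j + Y j i \<le> Y i i + Y j j"
  shows "sum H S * (\<Sum>j\<in>S. y j) + (\<Sum>j\<in>S. H j * (\<Sum>i\<in>S. Y i j))
    \<le> sum H S * (\<Sum>i\<in>S. Y i i) + real (card S) * (\<Sum>j\<in>S. H j * y j)"
proof -
  let ?M = "\<lambda>i j. max (H j - H i) 0" and ?m = "\<lambda>i j. min (H i) (H j)"
  have "0 \<le> (\<Sum>i\<in>S. \<Sum>j\<in>S. ?M i j * (Y i i + y j - Y i j - y i))
      + (\<Sum>i\<in>S. \<Sum>j\<in>S. ?m i j * (Y i i + Y j j - Y i j - Y j i)) / 2"
    by (intro add_nonneg_nonneg divide_nonneg_nonneg sum_nonneg mult_nonneg_nonneg)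
       (use H tri diag in \<open>auto simp: algebra_simps\<close>)
  also have "(\<Sum>i\<in>S. \<Sum>j\<in>S. ?m i j * (Y i i + Y j j - Y i j - Y j i))
      = (\<Sum>i\<in>S. \<Sum>j\<in>S. ?m i j * (Y i i - Y i j)) + (\<Sum>i\<in>S. \<Sum>j\<in>S. ?m i j * (Y j j - Y j i))"
    by (simp add: sum.distrib[symmetric] algebra_simps)
  also have "(\<Sum>i\<in>S. \<Sum>j\<in>S. ?m i j * (Y j j - Y j i)) = (\<Sum>i\<in>S. \<Sum>j\<in>S. ?m i j * (Y i i - Y i j))"
    by (subst swap_sum) (simp add: min.commute)
  also have "((\<Sum>i\<in>S. \<Sum>j\<in>S. ?m i j * (Y i i - Y i j)) + (\<Sum>i\<in>S. \<Sum>j\<in>S. ?m i j * (Y i i - Y i j))) / 2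
      = (\<Sum>i\<in>S. \<Sum>j\<in>S. ?m i j * (Y i i - Y i j))"
    by simp
  also have "(\<Sum>i\<in>S. \<Sum>j\<in>S. ?M i j * (Y i i + y j - Y i j - y i))
      + (\<Sum>i\<in>S. \<Sum>j\<in>S. ?m i j * (Y i i - Y i j))
    = (\<Sum>i\<in>S. \<Sum>j\<in>S. (?M i j + ?m i j) * (Y i i - Y i j))
      + ((\<Sum>i\<in>S. \<Sum>j\<in>S. ?M i j * y j) - (\<Sum>i\<in>S. \<Sum>j\<in>S. ?M i j * y i))"
    by (simp add: sum.distrib[symmetric] sum_subtractf[symmetric] algebra_simps)
  also have "(\<Sum>i\<in>S. \<Sum>j\<in>S. ?M i j * y i) = (\<Sum>i\<in>S. \<Sum>j\<in>S. ?M j i * y j)"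
    by (rule swap_sum)
  also have "(\<Sum>i\<in>S. \<Sum>j\<in>S. ?M i j * y j) - (\<Sum>i\<in>S. \<Sum>j\<in>S. ?M j i * y j)
      = (\<Sum>i\<in>S. \<Sum>j\<in>S. (H j - H i) * y j)"
    unfolding sum_subtractf[symmetric] by (intro sum.cong refl) (auto simp: max_def algebra_simps)
  also have "\<dots> = real (card S) * (\<Sum>j\<in>S. H j * y j) - sum H S * (\<Sum>j\<in>S. y j)"
    by (simp add: sum_subtractf left_diff_distrib sum_product)
  also have "(\<Sum>i\<in>S. \<Sum>j\<in>S. (?M i j + ?m i j) * (Y i i - Y i j)) = (\<Sum>i\<in>S. \<Sum>j\<in>S. H j * (Y i i - Y i j))"
    by (intro sum.cong refl arg_cong2[where f = "(*)"]) auto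
  also have "\<dots> = (\<Sum>i\<in>S. \<Sum>j\<in>S. H j * Y i i) - (\<Sum>i\<in>S. \<Sum>j\<in>S. H j * Y i j)"
    by (simp add: sum_subtractf right_diff_distrib)
  also have "(\<Sum>i\<in>S. \<Sum>j\<in>S. H j * Y i i) = sum H S * (\<Sum>i\<in>S. Y i i)"
    by (subst sum.swap) (simp add: sum_product)
  also have "(\<Sum>i\<in>S. \<Sum>j\<in>S. H j * Y i j) = (\<Sum>j\<in>S. H j * (\<Sum>i\<in>S. Y i j))"
    by (subst sum.swap) (simp add: sum_distrib_left)
  finally show ?thesis by simp
qed

text \<open>
  Every triangle inequality within the cluster is weighted by the distance between its legs,
  whatever its apex. This replaces the costs within the cluster by their row averages, which are
  nearly constant for a sample on a sphere whose mean is close to the centre.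
\<close>

lemma intra_inequality:
  fixes Y d :: "'a \<Rightarrow> 'a \<Rightarrow> real"
  assumes d: "\<And>j k. j \<in> S \<Longrightarrow> k \<in> S \<Longrightarrow> 0 \<le> d j k"
    and dsym: "\<And>j k. j \<in> S \<Longrightarrow> k \<in> S \<Longrightarrow> d j k = d k j"
    and tri: "\<And>i j k. i \<in> S \<Longrightarrow> j \<in> S \<Longrightarrow> k \<in> S \<Longrightarrow> Y i j + Y i k \<le> Y i i + Y j k"
    and S: "finite S" "S \<noteq> {}"
  shows "2 * (\<Sum>j\<in>S. avg S (d j) * (\<Sum>i\<in>S. Y i j)) 
    \<le> (\<Sum>j\<in>S. avg S (d j)) * (\<Sum>i\<in>S. Y i i) + (\<Sum>j\<in>S. \<Sum>k\<in>S. d j k * Y j k)"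
proof -
  define a where "a = real (card S)"
  have a: "a > 0" using S by (simp add: a_def card_gt_0_iff)
  have "0 \<le> (\<Sum>i\<in>S. \<Sum>j\<in>S. \<Sum>k\<in>S. d j k * (Y i i + Y j k - Y i j - Y i k))"
    by (intro sum_nonneg mult_nonneg_nonneg) (use d tri in \<open>auto simp: algebra_simps\<close>)
  also have "\<dots> = (\<Sum>i\<in>S. \<Sum>j\<in>S. \<Sum>k\<in>S. d j k * Y i i) + (\<Sum>i\<in>S. \<Sum>j\<in>S. \<Sum>k\<in>S. d j k * Y j k)
      - (\<Sum>i\<in>S. \<Sum>j\<in>S. \<Sum>k\<in>S. d j k * Y i j) - (\<Sum>i\<in>S. \<Sum>j\<in>S. \<Sum>k\<in>S. d j k * Y i k)"
    by (simp add: sum.distrib sum_subtractf algebra_simps)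
  also have "(\<Sum>i\<in>S. \<Sum>j\<in>S. \<Sum>k\<in>S. d j k * Y i k) = (\<Sum>i\<in>S. \<Sum>j\<in>S. \<Sum>k\<in>S. d j k * Y i j)"
    by (intro sum.cong[OF refl] trans[OF swap_sum]) (simp add: dsym)
  also have "(\<Sum>i\<in>S. \<Sum>j\<in>S. \<Sum>k\<in>S. d j k * Y i j) = a * (\<Sum>j\<in>S. avg S (d j) * (\<Sum>i\<in>S. Y i j))"
  proof -
    have "(\<Sum>k\<in>S. d j k * Y i j) = a * (avg S (d j) * Y i j)" for i j
      using a by (simp add: avg_def a_def[symmetric] sum_distrib_right)
    then show ?thesis
      by (simp add: sum.swap[of "\<lambda>i j. avg S (d j) * Y i j" S S] sum_distrib_left[symmetric] del: sum.swap_restrict)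
  qed
  also have "(\<Sum>i\<in>S. \<Sum>j\<in>S. \<Sum>k\<in>S. d j k * Y i i) = a * ((\<Sum>j\<in>S. avg S (d j)) * (\<Sum>i\<in>S. Y i i))"
    using a by (simp add: avg_def a_def[symmetric] sum_divide_distrib[symmetric] sum_distrib_left[symmetric] sum_distrib_right[symmetric])
  also have "(\<Sum>i\<in>S. \<Sum>j\<in>S. \<Sum>k\<in>S. d j k * Y j k) = a * (\<Sum>j\<in>S. \<Sum>k\<in>S. d j k * Y j k)"
    by (simp add: a_def)
  finally have "0 \<le> a * ((\<Sum>j\<in>S. avg S (d j)) * (\<Sum>i\<in>S. Y i i) + (\<Sum>j\<in>S. \<Sum>k\<in>S. d j k * Y j k)
      - 2 * (\<Sum>j\<in>S. avg S (d j) * (\<Sum>i\<in>S. Y i j)))"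
    by (simp add: algebra_simps)
  then show ?thesis using a by (simp add: zero_le_mult_iff)
qed

lemma planted_matrix_simps:
  assumes "G1 \<inter> G2 = {}"
  shows "i \<in> G1 \<Longrightarrow> j \<in> G1 \<Longrightarrow> planted_matrix G1 G2 i j = 1 / real (card G1)"
    and "i \<in> G2 \<Longrightarrow> j \<in> G2 \<Longrightarrow> planted_matrix G1 G2 i j = 1 / real (card G2)"
    and "i \<in> G1 \<Longrightarrow> j \<in> G2 \<Longrightarrow> planted_matrix G1 G2 i j = 0"
    and "i \<in> G2 \<Longrightarrow> j \<in> G1 \<Longrightarrow> planted_matrix G1 G2 i j = 0"
  using assms by (auto simp: planted_matrix_def indicator_def)

lemma planted_matrix_feasible:
  assumes part: "planted_partition n G1 G2"
  shows "lp2_feasible n (planted_matrix G1 G2)"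
proof -
  have U: "{1..n} = G1 \<union> G2" and disj: "G1 \<inter> G2 = {}" and ne: "G1 \<noteq> {}" "G2 \<noteq> {}"
    using part by (auto simp: planted_partition_def)
  have "finite (G1 \<union> G2)" by (simp flip: U)
  then have fin: "finite G1" "finite G2" by auto
  note P = planted_matrix_simps[OF disj]
  have row: "(\<Sum>j\<in>G1 \<union> G2. planted_matrix G1 G2 i j) = 1" if "i \<in> G1 \<union> G2" for i
    using that by (auto simp: P ne fin sum.union_disjoint[OF fin disj])
  have tri: "planted_matrix G1 G2 i j + planted_matrix G1 G2 i k \<le> planted_matrix G1 G2 i i + planted_matrix G1 G2 j k"
    if "i \<in> G1 \<union> G2" "j \<in> G1 \<union> G2" "k \<in> G1 \<union> G2" for i j k
    using that by (auto simp: P)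
  have tr: "(\<Sum>i\<in>G1 \<union> G2. planted_matrix G1 G2 i i) = 2"
    by (simp add: P ne fin sum.union_disjoint[OF fin disj])
  show ?thesis
    unfolding lp2_feasible_def U using row tri tr
    by (auto simp: planted_matrix_def indicator_def)
qed

text \<open>
  The contribution of one cluster \<open>S\<close> to the dual bound: the inequality from the distances is added
  to the average over \<open>k \<in> K\<close> of the cut inequalities for the functions \<open>\<lambda>j. X j k\<close>, and the row sums
  turn sums over \<open>S\<close> into sums over the other cluster \<open>K\<close>.
\<close>

lemma cluster_lower_bound:
  fixes Y d X :: "'a \<Rightarrow> 'a \<Rightarrow> real"
  assumes S: "finite S" "S \<noteq> {}" and K: "finite K" "K \<noteq> {}"
    and d: "\<And>j k. j \<in> S \<Longrightarrow> k \<in> S \<Longrightarrow> 0 \<le> d j k"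
    and dsym: "\<And>j k. j \<in> S \<Longrightarrow> k \<in> S \<Longrightarrow> d j k = d k j"
    and X: "\<And>j k. j \<in> S \<Longrightarrow> k \<in> K \<Longrightarrow> 0 \<le> X j k"
    and tri: "\<And>i j k. i \<in> S \<Longrightarrow> j \<in> S \<Longrightarrow> k \<in> S \<union> K \<Longrightarrow> Y i j + Y i k \<le> Y i i + Y j k"
    and row: "\<And>j. j \<in> S \<Longrightarrow> (\<Sum>i\<in>S. Y i j) + (\<Sum>k\<in>K. Y j k) = 1"
  shows "(\<Sum>j\<in>S. avg S (d j)) + (\<Sum>j\<in>S. avg S (d j) + avg K (X j)) * (1 - (\<Sum>i\<in>S. Y i i))
    \<le> (\<Sum>j\<in>S. \<Sum>k\<in>S. d j k * Y j k) 
      + (\<Sum>j\<in>S. \<Sum>k\<in>K. (2 * avg S (d j) + avg K (X j) 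
          + real (card S) / real (card K) * (X j k - avg S (\<lambda>j. X j k))) * Y j k)"
proof -
  define a b T where "a = real (card S)" and "b = real (card K)" and "T = (\<Sum>i\<in>S. Y i i)"
  have pos: "a > 0" "b > 0" using S K by (simp_all add: a_def b_def card_gt_0_iff)
  have col: "(\<Sum>i\<in>S. Y i j) = 1 - (\<Sum>k\<in>K. Y j k)" if "j \<in> S" for j
    using row[OF that] by simp
  have col_weighted: "(\<Sum>j\<in>S. w j * (\<Sum>i\<in>S. Y i j)) = sum w S - (\<Sum>j\<in>S. \<Sum>k\<in>K. w j * Y j k)" for w :: "'a \<Rightarrow> real"
    by (simp add: col right_diff_distrib sum_subtractf sum_distrib_left)
  have intra: "2 * ((\<Sum>j\<in>S. avg S (d j)) - (\<Sum>j\<in>S. \<Sum>k\<in>K. avg S (d j) * Y j k))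
      \<le> (\<Sum>j\<in>S. avg S (d j)) * T + (\<Sum>j\<in>S. \<Sum>k\<in>S. d j k * Y j k)"
    using intra_inequality[of S d Y] d dsym tri S by (simp add: T_def col_weighted)
  have "(\<Sum>k\<in>K. (\<Sum>j\<in>S. X j k) * (\<Sum>j\<in>S. Y j k) + (\<Sum>j\<in>S. X j k * (\<Sum>i\<in>S. Y i j)))
      \<le> (\<Sum>k\<in>K. (\<Sum>j\<in>S. X j k) * T + a * (\<Sum>j\<in>S. X j k * Y j k))"
  proof (intro sum_mono)
    fix k assume k: "k \<in> K"
    have "Y i j + Y j i \<le> Y i i + Y j j" if "i \<in> S" "j \<in> S" for i j
      using tri[of i j j] tri[of j i i] that by simp
    then show "(\<Sum>j\<in>S. X j k) * (\<Sum>j\<in>S. Y j k) + (\<Sum>j\<in>S. X j k * (\<Sum>i\<in>S. Y i j))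
        \<le> (\<Sum>j\<in>S. X j k) * T + a * (\<Sum>j\<in>S. X j k * Y j k)"
      unfolding T_def a_def by (intro cut_inequality) (use X tri k in auto)
  qed
  moreover have "(\<Sum>k\<in>K. \<Sum>j\<in>S. X j k * (\<Sum>i\<in>S. Y i j)) = b * (\<Sum>j\<in>S. avg K (X j) * (\<Sum>i\<in>S. Y i j))"
  proof -
    have "(\<Sum>k\<in>K. X j k * c) = b * (avg K (X j) * c)" for j c
      using pos by (simp add: avg_def b_def[symmetric] sum_distrib_right)
    then show ?thesis by (subst sum.swap) (simp add: sum_distrib_left[of b])
  qed
  moreover have "(\<Sum>k\<in>K. (\<Sum>j\<in>S. X j k) * T) = b * ((\<Sum>j\<in>S. avg K (X j)) * T)"
    using pos unfolding sum_avg_swap by (simp add: b_def[symmetric] sum_distrib_right)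
  moreover have "(\<Sum>k\<in>K. (\<Sum>j\<in>S. X j k) * (\<Sum>j\<in>S. Y j k)) = b * (\<Sum>j\<in>S. \<Sum>k\<in>K. a / b * avg S (\<lambda>j. X j k) * Y j k)"
  proof -
    have "(\<Sum>j\<in>S. X j k) * y = b * (a / b * avg S (\<lambda>j. X j k) * y)" for k y
      using pos by (simp add: avg_def a_def[symmetric])
    then have "(\<Sum>k\<in>K. (\<Sum>j\<in>S. X j k) * (\<Sum>j\<in>S. Y j k))
        = (\<Sum>k\<in>K. \<Sum>j\<in>S. b * (a / b * avg S (\<lambda>j. X j k) * Y j k))"
      by (simp add: sum_distrib_left mult.assoc)
    also have "\<dots> = (\<Sum>j\<in>S. \<Sum>k\<in>K. b * (a / b * avg S (\<lambda>j. X j k) * Y j k))"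
      by (rule sum.swap)
    finally show ?thesis by (simp only: sum_distrib_left)
  qed
  moreover have "(\<Sum>k\<in>K. a * (\<Sum>j\<in>S. X j k * Y j k)) = b * (\<Sum>j\<in>S. \<Sum>k\<in>K. a / b * X j k * Y j k)"
    using pos by (subst sum.swap) (simp add: sum_distrib_left mult.assoc)
  ultimately have "b * ((\<Sum>j\<in>S. \<Sum>k\<in>K. a / b * avg S (\<lambda>j. X j k) * Y j k) + (\<Sum>j\<in>S. avg K (X j) * (\<Sum>i\<in>S. Y i j)))
      \<le> b * ((\<Sum>j\<in>S. avg K (X j)) * T + (\<Sum>j\<in>S. \<Sum>k\<in>K. a / b * X j k * Y j k))"
    by (simp add: sum.distrib distrib_left)
  then have inter: "(\<Sum>j\<in>S. \<Sum>k\<in>K. a / b * avg S (\<lambda>j. X j k) * Y j k) 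
        + ((\<Sum>j\<in>S. avg K (X j)) - (\<Sum>j\<in>S. \<Sum>k\<in>K. avg K (X j) * Y j k))
      \<le> (\<Sum>j\<in>S. avg K (X j)) * T + (\<Sum>j\<in>S. \<Sum>k\<in>K. a / b * X j k * Y j k)"
    using pos by (simp add: mult_le_cancel_left_pos col_weighted)
  have "(\<Sum>j\<in>S. \<Sum>k\<in>K. (2 * avg S (d j) + avg K (X j) + a / b * (X j k - avg S (\<lambda>j. X j k))) * Y j k)
      = 2 * (\<Sum>j\<in>S. \<Sum>k\<in>K. avg S (d j) * Y j k) + (\<Sum>j\<in>S. \<Sum>k\<in>K. avg K (X j) * Y j k)
        + (\<Sum>j\<in>S. \<Sum>k\<in>K. a / b * X j k * Y j k) - (\<Sum>j\<in>S. \<Sum>k\<in>K. a / b * avg S (\<lambda>j. X j k) * Y j k)"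
    unfolding sum_distrib_left sum.distrib[symmetric] sum_subtractf[symmetric]
    by (intro sum.cong refl) (simp only: algebra_simps)
  then show ?thesis
    using intra inter by (simp add: a_def[symmetric] b_def[symmetric] T_def[symmetric] sum.distrib algebra_simps)
qed

text \<open>
  The condition \<open>balance\<close> says that the traces of the two diagonal blocks occur with equal
  coefficients in the two cluster bounds. As the traces add up to 2, the trace terms then cancel, and
  the gap to the planted value is bounded by the sum of \<open>w i k * Y i k\<close> over the pairs of points in
  different clusters, where \<open>w i k\<close> is the difference of the two sides of \<open>strict\<close>.
\<close>

lemma lp2_recovers_if_certificate:
  fixes x :: "nat \<Rightarrow> real ^ 'm" and V W :: "nat \<Rightarrow> nat \<Rightarrow> real"
  defines "d \<equiv> \<lambda>i j. (norm (x i - x j))\<^sup>2"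
  assumes part: "planted_partition n G1 G2" and n: "3 \<le> n"
    and V: "\<And>i k. i \<in> G1 \<Longrightarrow> k \<in> G2 \<Longrightarrow> 0 \<le> V i k"
    and W: "\<And>i k. i \<in> G1 \<Longrightarrow> k \<in> G2 \<Longrightarrow> 0 \<le> W i k"
    and balance: "(\<Sum>i\<in>G1. avg G1 (d i) + avg G2 (V i)) = (\<Sum>k\<in>G2. avg G2 (d k) + avg G1 (\<lambda>i. W i k))"
    and strict: "\<And>i k. i \<in> G1 \<Longrightarrow> k \<in> G2 \<Longrightarrow>
       avg G2 (V i) + avg G1 (\<lambda>i. W i k)
       + real (card G1) / real (card G2) * (V i k - avg G1 (\<lambda>i. V i k))
       + real (card G2) / real (card G1) * (W i k - avg G2 (W i))
       < 2 * (d i k - avg G1 (d i) - avg G2 (d k))"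
  shows "lp2_recovers n G1 G2 x"
proof -
  let ?P = "planted_matrix G1 G2"
  have U: "{1..n} = G1 \<union> G2" and disj: "G1 \<inter> G2 = {}" and ne: "G1 \<noteq> {}" "G2 \<noteq> {}"
    using part by (auto simp: planted_partition_def)
  have "finite (G1 \<union> G2)" by (simp flip: U)
  then have fin: "finite G1" "finite G2" by auto
  have cpos: "real (card G1) > 0" "real (card G2) > 0" using fin ne by (simp_all add: card_gt_0_iff)
  note P = planted_matrix_simps[OF disj]
  have dsym: "d i j = d j i" for i j by (simp add: d_def norm_minus_commute)
  have split: "lp2_objective n x Y = (\<Sum>i\<in>G1. \<Sum>j\<in>G1. d i j * Y i j) + (\<Sum>k\<in>G2. \<Sum>l\<in>G2. d k l * Y k l)
      + 2 * (\<Sum>i\<in>G1. \<Sum>k\<in>G2. d i k * Y i k)"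
    if "lp2_feasible n Y" for Y
  proof -
    have "(\<Sum>k\<in>G2. \<Sum>i\<in>G1. d k i * Y k i) = (\<Sum>k\<in>G2. \<Sum>i\<in>G1. d i k * Y i k)"
      using lp2_feasible_sym[OF that, unfolded U]
      by (intro sum.cong refl arg_cong2[where f = "(*)"] dsym) auto
    also have "\<dots> = (\<Sum>i\<in>G1. \<Sum>k\<in>G2. d i k * Y i k)" by (rule sum.swap)
    finally have *: "(\<Sum>k\<in>G2. \<Sum>i\<in>G1. d k i * Y k i) = (\<Sum>i\<in>G1. \<Sum>k\<in>G2. d i k * Y i k)" .
    have "lp2_objective n x Y = (\<Sum>i\<in>G1 \<union> G2. \<Sum>j\<in>G1 \<union> G2. d i j * Y i j)"
      unfolding lp2_objective_def U d_def ..
    then show ?thesis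
      unfolding sum.union_disjoint[OF fin disj] using * by (simp add: sum.distrib)
  qed
  have rows: "(\<Sum>j\<in>G1. Y i j) + (\<Sum>k\<in>G2. Y i k) = 1" if "lp2_feasible n Y" "i \<in> G1 \<union> G2" for Y i
  proof -
    have "(\<Sum>j\<in>G1 \<union> G2. Y i j) = 1" using that unfolding lp2_feasible_def U by blast
    then show ?thesis by (simp add: sum.union_disjoint[OF fin disj])
  qed
  have trace: "(\<Sum>i\<in>G1. Y i i) + (\<Sum>k\<in>G2. Y k k) = 2" if "lp2_feasible n Y" for Y
  proof -
    have "(\<Sum>i\<in>G1 \<union> G2. Y i i) = 2" using that unfolding lp2_feasible_def U by blast
    then show ?thesis by (simp add: sum.union_disjoint[OF fin disj])
  qed
  have Pfeas: "lp2_feasible n ?P" using part by (rule planted_matrix_feasible)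
  have objP: "lp2_objective n x ?P = (\<Sum>i\<in>G1. avg G1 (d i)) + (\<Sum>k\<in>G2. avg G2 (d k))"
    by (simp add: split[OF Pfeas] P avg_def sum_divide_distrib)
  define w where "w i k = 2 * (d i k - avg G1 (d i) - avg G2 (d k)) - (avg G2 (V i) + avg G1 (\<lambda>i. W i k)
       + real (card G1) / real (card G2) * (V i k - avg G1 (\<lambda>i. V i k))
       + real (card G2) / real (card G1) * (W i k - avg G2 (W i)))" for i k
  have w: "w i k > 0" if "i \<in> G1" "k \<in> G2" for i k
    using strict[OF that] by (simp add: w_def)
  have bound: "lp2_objective n x ?P + (\<Sum>i\<in>G1. \<Sum>k\<in>G2. w i k * Y i k) \<le> lp2_objective n x Y"
    if feas: "lp2_feasible n Y" for Y
  proof -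
    note tri = lp2_feasible_triangle[OF feas n, unfolded U]
    note sym = lp2_feasible_sym[OF feas, unfolded U]
    note row = rows[OF feas] and tr = trace[OF feas]
    have row1: "(\<Sum>i\<in>G1. Y i j) + (\<Sum>k\<in>G2. Y j k) = 1" if "j \<in> G1" for j
    proof -
      have "(\<Sum>i\<in>G1. Y i j) = (\<Sum>i\<in>G1. Y j i)" using that by (intro sum.cong refl sym) auto
      then show ?thesis using row[of j] that by simp
    qed
    have row2: "(\<Sum>i\<in>G2. Y i j) + (\<Sum>k\<in>G1. Y j k) = 1" if "j \<in> G2" for j
    proof -
      have "(\<Sum>i\<in>G2. Y i j) = (\<Sum>i\<in>G2. Y j i)" using that by (intro sum.cong refl sym) auto
      then show ?thesis using row[of j] that by simp
    qed
    note c1 = cluster_lower_bound[OF fin(1) ne(1) fin(2) ne(2), of d V Y]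
    note c2 = cluster_lower_bound[OF fin(2) ne(2) fin(1) ne(1), of d "\<lambda>k i. W i k" Y]
    define M T1 T2 where "M = (\<Sum>i\<in>G1. avg G1 (d i) + avg G2 (V i))"
      and "T1 = (\<Sum>i\<in>G1. Y i i)" and "T2 = (\<Sum>k\<in>G2. Y k k)"
    have T: "M * (1 - T1) + M * (1 - T2) = 0"
      using tr unfolding T1_def[symmetric] T2_def[symmetric] by (simp add: distrib_left[symmetric])
    have b1: "(\<Sum>j\<in>G1. avg G1 (d j)) + M * (1 - T1) \<le> (\<Sum>j\<in>G1. \<Sum>k\<in>G1. d j k * Y j k)
      + (\<Sum>j\<in>G1. \<Sum>k\<in>G2. (2 * avg G1 (d j) + avg G2 (V j) 
          + real (card G1) / real (card G2) * (V j k - avg G1 (\<lambda>j. V j k))) * Y j k)"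
      unfolding M_def T1_def
      by (rule c1) (use V dsym tri row1 in \<open>auto simp: d_def\<close>)
    have b2: "(\<Sum>j\<in>G2. avg G2 (d j)) + M * (1 - T2) \<le> (\<Sum>j\<in>G2. \<Sum>k\<in>G2. d j k * Y j k)
      + (\<Sum>j\<in>G2. \<Sum>k\<in>G1. (2 * avg G2 (d j) + avg G1 (\<lambda>i. W i j)
          + real (card G2) / real (card G1) * (W k j - avg G2 (W k))) * Y j k)"
      unfolding M_def T2_def balance
      by (rule c2) (use W dsym tri row2 in \<open>auto simp: d_def\<close>)
    have "(\<Sum>j\<in>G2. \<Sum>k\<in>G1. (2 * avg G2 (d j) + avg G1 (\<lambda>i. W i j)
          + real (card G2) / real (card G1) * (W k j - avg G2 (W k))) * Y j k)
       = (\<Sum>k\<in>G1. \<Sum>j\<in>G2. (2 * avg G2 (d j) + avg G1 (\<lambda>i. W i j)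
          + real (card G2) / real (card G1) * (W k j - avg G2 (W k))) * Y k j)"
      by (subst sum.swap, intro sum.cong refl arg_cong2[where f = "(*)"] sym) auto
    note b2 = b2[unfolded this]
    have "(\<Sum>i\<in>G1. \<Sum>k\<in>G2. w i k * Y i k) 
      + (\<Sum>j\<in>G1. \<Sum>k\<in>G2. (2 * avg G1 (d j) + avg G2 (V j) 
          + real (card G1) / real (card G2) * (V j k - avg G1 (\<lambda>j. V j k))) * Y j k)
      + (\<Sum>k\<in>G1. \<Sum>j\<in>G2. (2 * avg G2 (d j) + avg G1 (\<lambda>i. W i j)
          + real (card G2) / real (card G1) * (W k j - avg G2 (W k))) * Y k j)
      = 2 * (\<Sum>i\<in>G1. \<Sum>k\<in>G2. d i k * Y i k)"
      unfolding sum_distrib_left sum.distrib[symmetric] w_def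
      by (intro sum.cong refl) (simp only: algebra_simps)
    then show ?thesis
      using b1 b2 T by (simp add: split[OF feas] objP)
  qed
  have nonneg: "0 \<le> Y i k" if "lp2_feasible n Y" "i \<in> G1" "k \<in> G2" for Y i k
  proof -
    have "i \<in> {1..n}" "k \<in> {1..n}" "i \<noteq> k" using that U disj by auto
    then show ?thesis by (rule lp2_feasible_nonneg[OF that(1)])
  qed
  have opt: "lp2_optimal n x ?P"
    unfolding lp2_optimal_def
  proof (intro conjI allI impI Pfeas)
    fix Y assume Y: "lp2_feasible n Y"
    have "0 \<le> (\<Sum>i\<in>G1. \<Sum>k\<in>G2. w i k * Y i k)"
      using w nonneg[OF Y] by (intro sum_nonneg mult_nonneg_nonneg) (auto intro: less_imp_le)
    then show "lp2_objective n x ?P \<le> lp2_objective n x Y" using bound[OF Y] by simp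
  qed
  have "Y i j = ?P i j" if Yopt: "lp2_optimal n x Y" and ij: "i \<in> {1..n}" "j \<in> {1..n}" for Y i j
  proof -
    have Y: "lp2_feasible n Y" using Yopt by (simp add: lp2_optimal_def)
    note tri = lp2_feasible_triangle[OF Y n, unfolded U]
    note sym = lp2_feasible_sym[OF Y, unfolded U]
    have "lp2_objective n x Y \<le> lp2_objective n x ?P" using Yopt Pfeas by (simp add: lp2_optimal_def)
    then have "(\<Sum>i\<in>G1. \<Sum>k\<in>G2. w i k * Y i k) \<le> 0" using bound[OF Y] by simp
    moreover have terms: "0 \<le> w i k * Y i k" if "i \<in> G1" "k \<in> G2" for i k
      using w[OF that] nonneg[OF Y that] by simp
    ultimately have "(\<Sum>i\<in>G1. \<Sum>k\<in>G2. w i k * Y i k) = 0"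
      by (intro antisym sum_nonneg) auto
    then have "w i k * Y i k = 0" if "i \<in> G1" "k \<in> G2" for i k
      using that terms fin by (auto simp: sum_nonneg_eq_0_iff sum_nonneg)
    then have zero: "Y i k = 0" "Y k i = 0" if "i \<in> G1" "k \<in> G2" for i k
      using w[OF that] that sym[of i k] by fastforce+
    note row = rows[OF Y] and tr = trace[OF Y]
    \<comment> \<open>Without mass between the clusters, the triangle inequality with one leg in the other cluster
      bounds each row by its diagonal entry. So each block has trace at least 1, hence exactly 1, and
      all these bounds are equalities.\<close>
    obtain i0 k0 where i0: "i0 \<in> G1" and k0: "k0 \<in> G2" using ne by blast
    have le1: "Y i j \<le> Y i i" if "i \<in> G1" "j \<in> G1" for i j
      using tri[of i j k0] zero that k0 by auto
    have le2: "Y i j \<le> Y i i" if "i \<in> G2" "j \<in> G2" for i j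
      using tri[of i j i0] zero that i0 by auto
    have r1: "(\<Sum>j\<in>G1. Y i j) = 1" if "i \<in> G1" for i using row[of i] zero that by simp
    have r2: "(\<Sum>j\<in>G2. Y i j) = 1" if "i \<in> G2" for i using row[of i] zero that by simp
    have d1: "1 / real (card G1) \<le> Y i i" if "i \<in> G1" for i
      using sum_bounded_above[of G1 "Y i" "Y i i"] le1[OF that] r1[OF that] cpos
      by (simp add: field_simps)
    have d2: "1 / real (card G2) \<le> Y i i" if "i \<in> G2" for i
      using sum_bounded_above[of G2 "Y i" "Y i i"] le2[OF that] r2[OF that] cpos
      by (simp add: field_simps)
    have t1: "1 \<le> (\<Sum>i\<in>G1. Y i i)" using sum_mono[of G1 "\<lambda>_. 1 / real (card G1)" "\<lambda>i. Y i i"] d1 cpos by simp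
    have t2: "1 \<le> (\<Sum>i\<in>G2. Y i i)" using sum_mono[of G2 "\<lambda>_. 1 / real (card G2)" "\<lambda>i. Y i i"] d2 cpos by simp
    have e1: "Y i i = 1 / real (card G1)" if "i \<in> G1" for i
    proof -
      have "(\<Sum>i\<in>G1. Y i i - 1 / real (card G1)) = 0" using tr t1 t2 cpos by (simp add: sum_subtractf)
      then have "\<forall>i\<in>G1. Y i i - 1 / real (card G1) = 0"
        using d1 fin by (subst (asm) sum_nonneg_eq_0_iff) auto
      then show ?thesis using that by simp
    qed
    have e2: "Y i i = 1 / real (card G2)" if "i \<in> G2" for i
    proof -
      have "(\<Sum>i\<in>G2. Y i i - 1 / real (card G2)) = 0" using tr t1 t2 cpos by (simp add: sum_subtractf)
      then have "\<forall>i\<in>G2. Y i i - 1 / real (card G2) = 0"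
        using d2 fin by (subst (asm) sum_nonneg_eq_0_iff) auto
      then show ?thesis using that by simp
    qed
    have f1: "Y i j = 1 / real (card G1)" if "i \<in> G1" "j \<in> G1" for i j
    proof -
      have "(\<Sum>j\<in>G1. 1 / real (card G1) - Y i j) = 0" using r1[OF that(1)] cpos by (simp add: sum_subtractf)
      then have "\<forall>j\<in>G1. 1 / real (card G1) - Y i j = 0"
        using le1[OF that(1)] e1[OF that(1)] fin by (subst (asm) sum_nonneg_eq_0_iff) auto
      then have "1 / real (card G1) - Y i j = 0" using that(2) by (rule bspec)
      then show ?thesis by simp
    qed
    have f2: "Y i j = 1 / real (card G2)" if "i \<in> G2" "j \<in> G2" for i j
    proof -
      have "(\<Sum>j\<in>G2. 1 / real (card G2) - Y i j) = 0" using r2[OF that(1)] cpos by (simp add: sum_subtractf)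
      then have "\<forall>j\<in>G2. 1 / real (card G2) - Y i j = 0"
        using le2[OF that(1)] e2[OF that(1)] fin by (subst (asm) sum_nonneg_eq_0_iff) auto
      then have "1 / real (card G2) - Y i j = 0" using that(2) by (rule bspec)
      then show ?thesis by simp
    qed
    show ?thesis using ij unfolding U by (auto simp: f1 f2 zero P)
  qed
  then show ?thesis using opt unfolding lp2_recovers_def by blast
qed

section \<open>Measurability of the recovery event\<close>

text \<open>
  On a compact set a continuous function is positive iff it exceeds some \<open>1 / Suc p\<close>, and this
  weak inequality need only be tested on a countable dense subset.
\<close>

lemma measurable_positive_on_compact:
  fixes g :: "'a \<Rightarrow> 'b :: {metric_space, second_countable_topology} \<Rightarrow> real"
  assumes K: "compact K" and cont: "\<And>x. continuous_on UNIV (g x)"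
    and meas [measurable]: "\<And>y. (\<lambda>x. g x y) \<in> borel_measurable M"
  shows "{x \<in> space M. \<forall>y\<in>K. 0 < g x y} \<in> sets M"
proof -
  obtain T where T: "countable T" "T \<subseteq> K" "K \<subseteq> closure T" using separable[of K] by auto
  have "(\<forall>y\<in>K. 0 < g x y) \<longleftrightarrow> (\<exists>p::nat. \<forall>y\<in>T. 1 / real (Suc p) \<le> g x y)" for x
  proof
    assume pos: "\<forall>y\<in>K. 0 < g x y"
    show "\<exists>p::nat. \<forall>y\<in>T. 1 / real (Suc p) \<le> g x y"
    proof (cases "K = {}")
      case False
      then obtain y0 where y0: "y0 \<in> K" "\<forall>y\<in>K. g x y0 \<le> g x y"
        using continuous_attains_inf[OF K _ continuous_on_subset[OF cont subset_UNIV]] by blast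
      then obtain p where "1 / real (Suc p) < g x y0" using pos nat_approx_posE by blast
      moreover have "g x y0 \<le> g x y" if "y \<in> T" for y using y0(2) T(2) that by blast
      ultimately show ?thesis by (meson less_imp_le order_trans)
    qed (use T in auto)
  next
    assume "\<exists>p::nat. \<forall>y\<in>T. 1 / real (Suc p) \<le> g x y"
    then obtain p :: nat where p: "\<forall>y\<in>T. 1 / real (Suc p) \<le> g x y" by blast
    have "closed {y. 1 / real (Suc p) \<le> g x y}" by (intro closed_Collect_le cont continuous_on_const)
    then have sub: "closure T \<subseteq> {y. 1 / real (Suc p) \<le> g x y}" using p by (intro closure_minimal) blast+
    show "\<forall>y\<in>K. 0 < g x y"
    proof
      fix y assume "y \<in> K"
      then have "1 / real (Suc p) \<le> g x y" using sub T(3) by blast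
      then show "0 < g x y" by (rule less_le_trans[rotated]) simp
    qed
  qed
  then have "{x \<in> space M. \<forall>y\<in>K. 0 < g x y} = (\<Union>p::nat. {x \<in> space M. \<forall>y\<in>T. 1 / real (Suc p) \<le> g x y})"
    by auto
  also have "\<dots> \<in> sets M"
    using T(1) by (intro sets.countable_UN' sets.sets_Collect_countable_Ball) auto
  finally show ?thesis .
qed

text \<open>
  A form of Tychonoff's theorem; it is applied twice to reach matrices with bounded entries.
\<close>

lemma compact_functions_into:
  assumes "compact (B :: 'b :: topological_space set)"
  shows "compact {f :: 'a \<Rightarrow> 'b. \<forall>i. f i \<in> B}"
proof -
  have "compactin (product_topology (\<lambda>i::'a. euclidean :: 'b topology) UNIV) (PiE UNIV (\<lambda>_. B))"
    using assms by (subst compactin_PiE) simp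
  then show ?thesis by (simp add: euclidean_product_topology PiE_UNIV_domain Pi_def)
qed

lemma continuous_matrix_entry: "continuous_on UNIV (\<lambda>Y :: nat \<Rightarrow> nat \<Rightarrow> real. Y i j)"
  by (rule continuous_on_product_then_coordinatewise[OF continuous_on_product_coordinates])

lemma lp2_feasible_bounded:
  assumes feas: "lp2_feasible n Y" and ij: "i \<in> {1..n}" "j \<in> {1..n}"
  shows "\<bar>Y i j\<bar> \<le> real n + 1"
proof -
  have off: "0 \<le> (\<Sum>j\<in>{1..n}-{i}. Y i j)" if "i \<in> {1..n}" for i
    using that by (intro sum_nonneg lp2_feasible_nonneg[OF feas]) auto
  have row: "(\<Sum>j\<in>{1..n}-{i}. Y i j) + Y i i = 1" if "i \<in> {1..n}" for i
  proof -
    have "(\<Sum>j\<in>{1..n}. Y i j) = 1" using feas that unfolding lp2_feasible_def by blast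
    moreover have "(\<Sum>j\<in>{1..n}. Y i j) = Y i i + (\<Sum>j\<in>{1..n}-{i}. Y i j)"
      using that by (intro sum.remove) auto
    ultimately show ?thesis by simp
  qed
  have le1: "Y i i \<le> 1" if "i \<in> {1..n}" for i using off[OF that] row[OF that] by simp
  have ge: "- real n \<le> Y i i"
  proof -
    have "2 = (\<Sum>i\<in>{1..n}. Y i i)" using feas unfolding lp2_feasible_def by simp
    also have "\<dots> = Y i i + (\<Sum>j\<in>{1..n}-{i}. Y j j)" using ij by (intro sum.remove) auto
    also have "(\<Sum>j\<in>{1..n}-{i}. Y j j) \<le> (\<Sum>j\<in>{1..n}-{i}. 1)" by (intro sum_mono le1) auto
    finally show ?thesis using ij by simp
  qed
  show ?thesis
  proof (cases "i = j")
    case True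
    then show ?thesis using ge le1[OF ij(1)] by simp
  next
    case False
    have "Y i j \<le> (\<Sum>j\<in>{1..n}-{i}. Y i j)"
      using False ij by (intro member_le_sum lp2_feasible_nonneg[OF feas]) auto
    then show ?thesis using row[OF ij(1)] ge lp2_feasible_nonneg[OF feas ij False] by simp
  qed
qed

text \<open>
  Matrices are functions of which only the entries with indices in \<open>{1..n}\<close> matter. Fixing the other
  entries selects one representative and makes the feasible set bounded.
\<close>

definition supported_on :: "nat \<Rightarrow> (nat \<Rightarrow> nat \<Rightarrow> real) \<Rightarrow> bool" where
  "supported_on n Y \<longleftrightarrow> (\<forall>i j. \<not> (i \<in> {1..n} \<and> j \<in> {1..n}) \<longrightarrow> Y i j = 0)"

lemma compact_lp2_feasible: "compact {Y. lp2_feasible n Y \<and> supported_on n Y}"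
proof -
  have box: "compact {Y :: nat \<Rightarrow> nat \<Rightarrow> real. \<forall>i. Y i \<in> {v. \<forall>j. v j \<in> {- (real n + 1)..real n + 1}}}"
    by (intro compact_functions_into) simp
  have closed: "closed {Y. lp2_feasible n Y \<and> supported_on n Y}"
    unfolding lp2_feasible_def supported_on_def Ball_def
    by (intro closed_Collect_conj closed_Collect_all closed_Collect_imp closed_Collect_eq closed_Collect_le
        continuous_intros continuous_on_sum continuous_matrix_entry open_Collect_const)
  have sub: "{Y. lp2_feasible n Y \<and> supported_on n Y}
      \<subseteq> {Y. \<forall>i. Y i \<in> {v. \<forall>j. v j \<in> {- (real n + 1)..real n + 1}}}"
  proof clarify
    fix Y i j assume Y: "lp2_feasible n Y" "supported_on n Y"
    show "Y i j \<in> {- (real n + 1)..real n + 1}"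
    proof (cases "i \<in> {1..n} \<and> j \<in> {1..n}")
      case True
      then show ?thesis using lp2_feasible_bounded[OF Y(1), of i j] by (auto simp: abs_le_iff)
    next
      case False
      then show ?thesis using Y(2) by (auto simp: supported_on_def)
    qed
  qed
  show ?thesis using compact_Int_closed[OF box closed] sub by (simp only: Int_absorb1)
qed

lemma lp2_feasible_cong:
  assumes "\<And>i j. i \<in> {1..n} \<Longrightarrow> j \<in> {1..n} \<Longrightarrow> Y i j = Z i j"
  shows "lp2_feasible n Y \<longleftrightarrow> lp2_feasible n Z"
proof -
  have "lp2_feasible n Y" if Z: "lp2_feasible n Z" and eq: "\<And>i j. i \<in> {1..n} \<Longrightarrow> j \<in> {1..n} \<Longrightarrow> Y i j = Z i j" for Y Z
    unfolding lp2_feasible_def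
  proof (intro conjI ballI impI)
    have "(\<Sum>i=1..n. Y i i) = (\<Sum>i=1..n. Z i i)" by (intro sum.cong refl eq)
    also have "\<dots> = 2" using Z unfolding lp2_feasible_def by blast
    finally show "(\<Sum>i=1..n. Y i i) = 2" .
    show "(\<Sum>j=1..n. Y i j) = 1" if "i \<in> {1..n}" for i
    proof -
      have "(\<Sum>j=1..n. Y i j) = (\<Sum>j=1..n. Z i j)" by (intro sum.cong refl eq that)
      also have "\<dots> = 1" using Z that unfolding lp2_feasible_def by blast
      finally show ?thesis .
    qed
    show "Y i j = Y j i" if "i \<in> {1..n}" "j \<in> {1..n}" for i j
      using lp2_feasible_sym[OF Z that] eq[OF that] eq[OF that(2,1)] by simp
    show "0 \<le> Y i j" if "i \<in> {1..n}" "j \<in> {1..n}" "i < j" for i j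
      using lp2_feasible_nonneg[OF Z that(1,2)] eq[OF that(1,2)] that(3) by simp
    show "Y i j + Y i k \<le> Y i i + Y j k"
      if "i \<in> {1..n}" "j \<in> {1..n}" "k \<in> {1..n}" "i \<noteq> j \<and> i \<noteq> k \<and> j < k" for i j k
    proof -
      have "Z i j + Z i k \<le> Z i i + Z j k" using Z that unfolding lp2_feasible_def by blast
      then show ?thesis
        unfolding eq[OF that(1,2)] eq[OF that(1,3)] eq[OF that(1,1)] eq[OF that(2,3)] .
    qed
  qed
  note transfer = this
  show ?thesis
  proof
    show "lp2_feasible n Z" if "lp2_feasible n Y"
      using that by (rule transfer) (rule assms[symmetric])
    show "lp2_feasible n Y" if "lp2_feasible n Z"
      using that by (rule transfer) (rule assms)
  qed
qed

lemma lp2_objective_cong: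
  assumes "\<And>i j. i \<in> {1..n} \<Longrightarrow> j \<in> {1..n} \<Longrightarrow> Y i j = Z i j"
  shows "lp2_objective n x Y = lp2_objective n x Z"
proof -
  have "(norm (x i - x j))\<^sup>2 * Y i j = (norm (x i - x j))\<^sup>2 * Z i j" if "i \<in> {1..n}" "j \<in> {1..n}" for i j
    unfolding assms[OF that] ..
  then show ?thesis unfolding lp2_objective_def by (intro sum.cong refl)
qed

text \<open>
  The feasible matrices other than the planted one form a countable union of compact sets, those of
  distance at least \<open>1 / Suc p\<close> from it. So recovery is a countable conjunction of conditions to which
  \<open>measurable_positive_on_compact\<close> applies.
\<close>

lemma lp2_recovers_iff:
  assumes part: "planted_partition n G1 G2"
  defines "P \<equiv> planted_matrix G1 G2"
  shows "lp2_recovers n G1 G2 x \<longleftrightarrow>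
    (\<forall>p::nat. \<forall>Y\<in>{Y. lp2_feasible n Y \<and> supported_on n Y} \<inter> {Y. 1 / real (Suc p) \<le> (\<Sum>i=1..n. \<Sum>j=1..n. \<bar>Y i j - P i j\<bar>)}.
       0 < lp2_objective n x Y - lp2_objective n x P)" (is "?L \<longleftrightarrow> ?R")
proof
  have Pf: "lp2_feasible n P" unfolding P_def using part by (rule planted_matrix_feasible)
  {
    assume L: ?L
    show ?R
    proof (intro allI ballI)
      fix p :: nat and Y
      assume Y: "Y \<in> {Y. lp2_feasible n Y \<and> supported_on n Y} \<inter> {Y. 1 / real (Suc p) \<le> (\<Sum>i=1..n. \<Sum>j=1..n. \<bar>Y i j - P i j\<bar>)}"
      have "\<not> (\<forall>i\<in>{1..n}. \<forall>j\<in>{1..n}. Y i j = P i j)"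
      proof
        assume "\<forall>i\<in>{1..n}. \<forall>j\<in>{1..n}. Y i j = P i j"
        then have "(\<Sum>i=1..n. \<Sum>j=1..n. \<bar>Y i j - P i j\<bar>) = 0" by (intro sum.neutral ballI) auto
        moreover have "0 < 1 / real (Suc p)" by simp
        ultimately show False using Y by (simp del: of_nat_Suc)
      qed
      then have "\<not> lp2_optimal n x Y" using L unfolding lp2_recovers_def P_def by blast
      moreover have "\<And>Z. lp2_feasible n Z \<Longrightarrow> lp2_objective n x P \<le> lp2_objective n x Z"
        using L unfolding lp2_recovers_def lp2_optimal_def P_def by blast
      ultimately show "0 < lp2_objective n x Y - lp2_objective n x P"
        using Y unfolding lp2_optimal_def by (auto simp: not_le) (meson le_less_trans not_le)
    qed
  }
  {
    assume R: ?R
    have better: "lp2_objective n x P < lp2_objective n x Y"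
      if Y: "lp2_feasible n Y" and ij: "i \<in> {1..n}" "j \<in> {1..n}" "Y i j \<noteq> P i j" for Y i j
    proof -
      define Z where "Z i j = (if i \<in> {1..n} \<and> j \<in> {1..n} then Y i j else 0)" for i j
      have ZY: "Z i j = Y i j" if "i \<in> {1..n}" "j \<in> {1..n}" for i j using that by (simp add: Z_def)
      have "0 < \<bar>Z i j - P i j\<bar>" using ij ZY by simp
      also have "\<bar>Z i j - P i j\<bar> \<le> (\<Sum>j=1..n. \<bar>Z i j - P i j\<bar>)"
        using ij by (intro member_le_sum[of j _ "\<lambda>j. \<bar>Z i j - P i j\<bar>"]) auto
      also have "\<dots> \<le> (\<Sum>i=1..n. \<Sum>j=1..n. \<bar>Z i j - P i j\<bar>)"
        using ij by (intro member_le_sum[of i _ "\<lambda>i. \<Sum>j=1..n. \<bar>Z i j - P i j\<bar>"] sum_nonneg) auto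
      finally obtain p where "1 / real (Suc p) < (\<Sum>i=1..n. \<Sum>j=1..n. \<bar>Z i j - P i j\<bar>)"
        using nat_approx_posE by blast
      moreover have "lp2_feasible n Z" using Y by (rule iffD2[OF lp2_feasible_cong, rotated]) (rule ZY)
      moreover have "supported_on n Z" by (auto simp: supported_on_def Z_def)
      ultimately have "Z \<in> {Y. lp2_feasible n Y \<and> supported_on n Y}
          \<inter> {Y. 1 / real (Suc p) \<le> (\<Sum>i=1..n. \<Sum>j=1..n. \<bar>Y i j - P i j\<bar>)}"
        by (simp only: Int_iff mem_Collect_eq less_imp_le simp_thms)
      then have "0 < lp2_objective n x Z - lp2_objective n x P" using R by blast
      moreover have "lp2_objective n x Z = lp2_objective n x Y" by (rule lp2_objective_cong) (rule ZY)
      ultimately show ?thesis by simp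
    qed
    have le: "lp2_objective n x P \<le> lp2_objective n x Y" if Y: "lp2_feasible n Y" for Y
    proof (cases "\<forall>i\<in>{1..n}. \<forall>j\<in>{1..n}. Y i j = P i j")
      case True
      then have "Y i j = P i j" if "i \<in> {1..n}" "j \<in> {1..n}" for i j using that by blast
      then have "lp2_objective n x Y = lp2_objective n x P" by (rule lp2_objective_cong)
      then show ?thesis by simp
    next
      case False
      then obtain i j where "i \<in> {1..n}" "j \<in> {1..n}" "Y i j \<noteq> P i j" by blast
      with Y have "lp2_objective n x P < lp2_objective n x Y" by (rule better)
      then show ?thesis by simp
    qed
    show ?L
      unfolding lp2_recovers_def lp2_optimal_def P_def[symmetric]
    proof (intro conjI allI impI ballI)
      show "lp2_feasible n P" by (rule Pf)
      show "lp2_objective n x P \<le> lp2_objective n x Y" if "lp2_feasible n Y" for Y using that by (rule le)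
      fix Y i j assume Y: "lp2_feasible n Y \<and> (\<forall>Z. lp2_feasible n Z \<longrightarrow> lp2_objective n x Y \<le> lp2_objective n x Z)"
        and ij: "i \<in> {1..n}" "j \<in> {1..n}"
      have "lp2_objective n x Y \<le> lp2_objective n x P"
        by (rule conjunct2[OF Y, rule_format, OF Pf])
      moreover have "lp2_objective n x P < lp2_objective n x Y" if "Y i j \<noteq> P i j"
        using conjunct1[OF Y] ij that by (rule better)
      ultimately show "Y i j = P i j" by linarith
    qed
  }
qed

lemma sets_lp2_recovers:
  fixes c1 c2 :: "real ^ 'm"
  assumes part: "planted_partition n G1 G2"
  defines "M \<equiv> stochastic_sphere_model c1 c2 G1 G2"
  shows "{x \<in> space M. lp2_recovers n G1 G2 x} \<in> sets M"
proof -
  let ?P = "planted_matrix G1 G2"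
  let ?K = "\<lambda>p::nat. {Y. lp2_feasible n Y \<and> supported_on n Y} \<inter> {Y. 1 / real (Suc p) \<le> (\<Sum>i=1..n. \<Sum>j=1..n. \<bar>Y i j - ?P i j\<bar>)}"
  have U: "{1..n} = G1 \<union> G2" using part by (auto simp: planted_partition_def)
  have K: "compact (?K p)" for p
    by (intro compact_Int_closed compact_lp2_feasible closed_Collect_le continuous_intros
        continuous_on_sum continuous_matrix_entry)
  have [measurable]: "(\<lambda>x. x i) \<in> borel_measurable M" if "i \<in> {1..n}" for i
  proof -
    have "i \<in> G1 \<union> G2" using that U by blast
    then have "(\<lambda>x. x i) \<in> measurable M (uniform_sphere (if i \<in> G1 then c1 else c2))"
      unfolding M_def stochastic_sphere_model_def by (rule measurable_component_singleton)
    then show ?thesis by (simp cong: measurable_cong_sets)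
  qed
  have "{x \<in> space M. \<forall>Y\<in>?K p. 0 < lp2_objective n x Y - lp2_objective n x ?P} \<in> sets M" for p
  proof (rule measurable_positive_on_compact[OF K])
    show "continuous_on UNIV (\<lambda>Y. lp2_objective n x Y - lp2_objective n x ?P)" for x :: "nat \<Rightarrow> real ^ 'm"
      unfolding lp2_objective_def by (intro continuous_intros continuous_on_sum continuous_matrix_entry)
    show "(\<lambda>x. lp2_objective n x Y - lp2_objective n x ?P) \<in> borel_measurable M" for Y
      unfolding lp2_objective_def by measurable
  qed
  then have "(\<Inter>p. {x \<in> space M. \<forall>Y\<in>?K p. 0 < lp2_objective n x Y - lp2_objective n x ?P}) \<in> sets M"
    by (intro sets.countable_INT image_subsetI UNIV_not_empty)
  also have "(\<Inter>p. {x \<in> space M. Q p x}) = {x \<in> space M. \<forall>p. Q p x}" for Q :: "nat \<Rightarrow> (nat \<Rightarrow> real ^ 'm) \<Rightarrow> bool"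
    by blast
  finally show ?thesis unfolding lp2_recovers_iff[OF part] .
qed

section \<open>Odd kernels and nearly centred samples\<close>

definition odd_bounded :: "(real ^ 'm \<Rightarrow> real) \<Rightarrow> bool" where
  "odd_bounded \<alpha> \<longleftrightarrow> \<alpha> \<in> borel_measurable borel \<and> (\<forall>y. \<alpha> (- y) = - \<alpha> y) \<and> (\<exists>C. \<forall>y. norm y = 1 \<longrightarrow> \<bar>\<alpha> y\<bar> \<le> C)"

text \<open>
  The averages of such a kernel over one variable are small, uniformly in the other one, as soon as
  the averages of finitely many odd functions are small.
\<close>

inductive odd_kernel :: "(real ^ 'm \<Rightarrow> real ^ 'm \<Rightarrow> real) \<Rightarrow> bool" where
  prod: "odd_bounded \<alpha> \<Longrightarrow> odd_bounded \<beta> \<Longrightarrow> odd_kernel (\<lambda>y z. \<alpha> y * \<beta> z)"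
| add: "odd_kernel U \<Longrightarrow> odd_kernel V \<Longrightarrow> odd_kernel (\<lambda>y z. U y z + V y z)"

lemma odd_kernel_sum:
  assumes "finite L" "\<And>l. l \<in> L \<Longrightarrow> odd_kernel (U l)"
  shows "odd_kernel (\<lambda>y z. \<Sum>l\<in>L. U l y z)"
  using assms
proof (induction L rule: finite_induct)
  case empty
  have "odd_bounded (\<lambda>y :: real ^ 'm. 0)" by (auto simp: odd_bounded_def)
  from odd_kernel.prod[OF this this] show ?case by simp
next
  case (insert l L)
  then show ?case by (simp add: odd_kernel.add)
qed

lemma odd_kernel_inner: "odd_kernel (\<lambda>y z :: real ^ 'm. y \<bullet> z)"
proof -
  have "odd_bounded (\<lambda>y :: real ^ 'm. y \<bullet> v)" for v
    unfolding odd_bounded_def by (auto intro!: exI[of _ "norm v"] Cauchy_Schwarz_ineq2[THEN order_trans])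
  then have "odd_kernel (\<lambda>y z :: real ^ 'm. \<Sum>v\<in>Basis. (y \<bullet> v) * (z \<bullet> v))"
    by (intro odd_kernel_sum odd_kernel.prod) auto
  then show ?thesis by (simp add: euclidean_inner[symmetric])
qed

definition nearly_centred :: "(real ^ 'm \<Rightarrow> real) set \<Rightarrow> real \<Rightarrow> nat set \<Rightarrow> (nat \<Rightarrow> real ^ 'm) \<Rightarrow> bool" where
  "nearly_centred A \<eta> S y \<longleftrightarrow> (\<forall>i\<in>S. norm (y i) = 1) \<and> (\<forall>\<alpha>\<in>A. \<bar>avg S (\<lambda>i. \<alpha> (y i))\<bar> \<le> \<eta>)"

lemma nearly_centred_mono:
  "nearly_centred A \<eta> S y \<Longrightarrow> A' \<subseteq> A \<Longrightarrow> \<eta> \<le> \<eta>' \<Longrightarrow> nearly_centred A' \<eta>' S y"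
  unfolding nearly_centred_def by (meson order_trans subsetD)

lemma odd_kernel_averages:
  assumes "odd_kernel U" "0 < \<delta>"
  shows "\<exists>A \<eta>. finite A \<and> (\<forall>\<alpha>\<in>A. odd_bounded \<alpha>) \<and> 0 < \<eta> \<and>
    (\<forall>S y z. nearly_centred A \<eta> S y \<longrightarrow> norm z = 1 \<longrightarrow>
       \<bar>avg S (\<lambda>i. U (y i) z)\<bar> \<le> \<delta> \<and> \<bar>avg S (\<lambda>i. U z (y i))\<bar> \<le> \<delta>)"
  using assms
proof (induction arbitrary: \<delta> rule: odd_kernel.induct)
  case (prod \<alpha> \<beta>)
  obtain C where C: "\<And>y. norm y = 1 \<Longrightarrow> \<bar>\<alpha> y\<bar> \<le> C" using prod(1) by (auto simp: odd_bounded_def)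
  obtain C' where C': "\<And>y. norm y = 1 \<Longrightarrow> \<bar>\<beta> y\<bar> \<le> C'" using prod(2) by (auto simp: odd_bounded_def)
  define B where "B = \<bar>C\<bar> + \<bar>C'\<bar> + 1"
  have B: "B > 0" by (simp add: B_def)
  have bounds: "\<bar>\<alpha> y\<bar> \<le> B" "\<bar>\<beta> y\<bar> \<le> B" if "norm y = 1" for y
    using C[OF that] C'[OF that] by (auto simp: B_def)
  have small: "\<bar>u * v\<bar> \<le> \<delta>" "\<bar>v * u\<bar> \<le> \<delta>" if "\<bar>u\<bar> \<le> \<delta> / B" "\<bar>v\<bar> \<le> B" for u v :: real
    using mult_mono[OF that] B prod.prems by (simp_all add: abs_mult mult.commute)
  show ?case
    by (intro exI[of _ "{\<alpha>, \<beta>}"] exI[of _ "\<delta> / B"])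
       (use prod B small bounds in \<open>auto simp: nearly_centred_def avg_multc avg_cmult\<close>)
next
  case (add U V)
  obtain A \<eta> where A: "finite A" "\<forall>\<alpha>\<in>A. odd_bounded \<alpha>" "0 < \<eta>"
    and *: "\<And>S y z. nearly_centred A \<eta> S y \<Longrightarrow> norm z = 1 \<Longrightarrow>
       \<bar>avg S (\<lambda>i. U (y i) z)\<bar> \<le> \<delta> / 2 \<and> \<bar>avg S (\<lambda>i. U z (y i))\<bar> \<le> \<delta> / 2"
    using add.IH(1)[of "\<delta> / 2"] add.prems by auto
  obtain A' \<eta>' where A': "finite A'" "\<forall>\<alpha>\<in>A'. odd_bounded \<alpha>" "0 < \<eta>'"
    and **: "\<And>S y z. nearly_centred A' \<eta>' S y \<Longrightarrow> norm z = 1 \<Longrightarrow>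
       \<bar>avg S (\<lambda>i. V (y i) z)\<bar> \<le> \<delta> / 2 \<and> \<bar>avg S (\<lambda>i. V z (y i))\<bar> \<le> \<delta> / 2"
    using add.IH(2)[of "\<delta> / 2"] add.prems by auto
  show ?case
  proof (intro exI[of _ "A \<union> A'"] exI[of _ "min \<eta> \<eta>'"] conjI allI impI)
    fix S y and z :: "real ^ 'a"
    assume c: "nearly_centred (A \<union> A') (min \<eta> \<eta>') S y" and z: "norm z = 1"
    have "nearly_centred A \<eta> S y" "nearly_centred A' \<eta>' S y"
      by (rule nearly_centred_mono[OF c]; simp)+
    from *[OF this(1) z] **[OF this(2) z]
    show "\<bar>avg S (\<lambda>i. U (y i) z + V (y i) z)\<bar> \<le> \<delta>" "\<bar>avg S (\<lambda>i. U z (y i) + V z (y i))\<bar> \<le> \<delta>"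
      by (auto simp: avg_add)
  qed (use A A' in auto)
qed

section \<open>Recovery from a kernel\<close>

text \<open>
  The arrays of the certificate are
  \<open>V = 2 * (\<rho> - 1) + \<rho> * (D * (1 - y \<bullet> e) + U y z + \<phi> z) + k1\<close> and
  \<open>W = D * (1 + z \<bullet> e) + (\<psi> y - 4 * (y \<bullet> z) - U y z) / \<rho> + k2\<close>. If all averages of odd functions
  vanish, then \<open>U\<close>, \<open>\<phi>\<close> and \<open>\<psi>\<close> drop out of the strict inequality of the certificate, and the
  remaining terms amount to \<open>k1 + k2\<close> being less than \<open>2 * (d \<Delta> - d \<Delta>0)\<close>, where \<open>d \<Delta>\<close> is the
  squared distance of the two points if the centres have distance \<open>\<Delta>\<close>. This difference equals
  \<open>2 * (\<Delta> - \<Delta>0) * (\<Delta> + \<Delta>0 - 2 * (y \<bullet> e - z \<bullet> e))\<close>, at least twice the number \<open>sl\<close> below. The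
  constants \<open>2 * (\<rho> - 1)\<close> and \<open>D\<close> make the certificate balanced for vanishing averages. At
  \<open>z = - e\<close>, the point of the second sphere that is closest to the first cluster, the mean of \<open>W\<close> is
  zero up to \<open>k2\<close>, which is why the threshold cannot be lowered in this construction.
\<close>

lemma recovers_if_kernel:
  fixes e :: "real ^ 'm" and \<phi> \<psi> :: "real ^ 'm \<Rightarrow> real"
  assumes \<rho>: "1 \<le> \<rho>" and D: "0 < D" and e: "norm e = 1"
    and \<Delta>0: "(1 + \<rho>) * D = 4 * \<Delta>0" "\<Delta>0\<^sup>2 = 2 * \<Delta>0 + 1 + \<rho>"
    and \<gamma>: "0 < \<gamma>" "(1 + \<rho>) * \<gamma> \<le> (\<Delta> - \<Delta>0) * (\<Delta> + \<Delta>0 - 4)" and \<Delta>: "\<Delta>0 < \<Delta>" "4 < \<Delta> + \<Delta>0"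
    and U: "odd_kernel U" and \<phi>: "odd_bounded \<phi>" and \<psi>: "odd_bounded \<psi>"
    and lower: "\<And>y z. norm y = 1 \<Longrightarrow> norm z = 1 \<Longrightarrow> - \<gamma> \<le> D * (1 - y \<bullet> e) + U y z + \<phi> z"
    and upper: "\<And>y z. norm y = 1 \<Longrightarrow> norm z = 1 \<Longrightarrow> 0 \<le> \<rho> * D * (1 + z \<bullet> e) - 4 * (y \<bullet> z) + \<psi> y - U y z"
  shows "\<exists>A \<eta>. finite A \<and> (\<forall>\<alpha>\<in>A. odd_bounded \<alpha>) \<and> 0 < \<eta> \<and>
    (\<forall>n G1 G2 c1 c2 x. planted_partition n G1 G2 \<longrightarrow> 3 \<le> n \<longrightarrow> real (card G2) = \<rho> * real (card G1) \<longrightarrow>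
       c2 - c1 = \<Delta> *\<^sub>R e \<longrightarrow> nearly_centred A \<eta> G1 (\<lambda>i. x i - c1) \<longrightarrow> nearly_centred A \<eta> G2 (\<lambda>k. x k - c2) \<longrightarrow>
       lp2_recovers n G1 G2 x)"
proof -
  define sl where "sl = (\<Delta> - \<Delta>0) * (\<Delta> + \<Delta>0 - 4)"
  have sl: "sl > 0" using \<Delta> by (simp add: sl_def)
  define C where "C = 2 * \<rho> * D + 4 * \<rho> + 8"
  define C2 where "C2 = (\<rho> + 2) * C + 2 * \<rho> + 20 + D + \<rho> * D"
  have "C > 0" using \<rho> D by (simp add: C_def add_pos_pos)
  then have C: "C > 0" "C2 > 0" using \<rho> D by (simp_all add: C2_def add_pos_pos)
  define \<delta> where "\<delta> = sl / (2 * C2)"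
  have \<delta>: "\<delta> > 0" "C2 * \<delta> < sl" using sl C by (simp_all add: \<delta>_def)
  obtain A1 \<eta>1 where A1: "finite A1" "\<forall>\<alpha>\<in>A1. odd_bounded \<alpha>" "0 < \<eta>1"
    and avgU: "\<And>S y z. nearly_centred A1 \<eta>1 S y \<Longrightarrow> norm z = 1 \<Longrightarrow>
       \<bar>avg S (\<lambda>i. U (y i) z)\<bar> \<le> \<delta> \<and> \<bar>avg S (\<lambda>i. U z (y i))\<bar> \<le> \<delta>"
    using odd_kernel_averages[OF U \<delta>(1)] by blast
  obtain A2 \<eta>2 where A2: "finite A2" "\<forall>\<alpha>\<in>A2. odd_bounded \<alpha>" "0 < \<eta>2"
    and avgI: "\<And>S (y :: nat \<Rightarrow> real ^ 'm) z. nearly_centred A2 \<eta>2 S y \<Longrightarrow> norm z = 1 \<Longrightarrow>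
       \<bar>avg S (\<lambda>i. y i \<bullet> z)\<bar> \<le> \<delta> \<and> \<bar>avg S (\<lambda>i. z \<bullet> y i)\<bar> \<le> \<delta>"
    using odd_kernel_averages[OF odd_kernel_inner \<delta>(1)] by blast
  define A where "A = A1 \<union> A2 \<union> {\<phi>, \<psi>}"
  define \<eta> where "\<eta> = min (min \<eta>1 \<eta>2) \<delta>"
  have "lp2_recovers n G1 G2 x"
    if part: "planted_partition n G1 G2" and n: "3 \<le> n" and card: "real (card G2) = \<rho> * real (card G1)"
      and c: "c2 - c1 = \<Delta> *\<^sub>R e" and cen1: "nearly_centred A \<eta> G1 (\<lambda>i. x i - c1)" 
      and cen2: "nearly_centred A \<eta> G2 (\<lambda>k. x k - c2)" for n G1 G2 c1 c2 x
  proof -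
    have ne: "G1 \<noteq> {}" "G2 \<noteq> {}" and Un: "{1..n} = G1 \<union> G2" using part by (auto simp: planted_partition_def)
    have "finite (G1 \<union> G2)" by (simp flip: Un)
    then have fin: "finite G1" "finite G2" by auto
    note avgc = avg_const[OF fin(1) ne(1)] avg_const[OF fin(2) ne(2)]
    note avgs = avg_add avg_diff avg_cmult avg_multc avgc
    have apos: "real (card G1) > 0" using fin ne by (simp add: card_gt_0_iff)
    define y z where "y i = x i - c1" and "z k = x k - c2" for i k
    have y1: "norm (y i) = 1" if "i \<in> G1" for i using cen1 that by (simp add: nearly_centred_def y_def)
    have z1: "norm (z k) = 1" if "k \<in> G2" for k using cen2 that by (simp add: nearly_centred_def z_def)
    have "nearly_centred A1 \<eta>1 G1 y" "nearly_centred A2 \<eta>2 G1 y" "nearly_centred {\<psi>} \<delta> G1 y"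
      unfolding y_def by (rule nearly_centred_mono[OF cen1]; simp add: A_def \<eta>_def; blast?)+
    note cy = this
    have "nearly_centred A1 \<eta>1 G2 z" "nearly_centred A2 \<eta>2 G2 z" "nearly_centred {\<phi>} \<delta> G2 z"
      unfolding z_def by (rule nearly_centred_mono[OF cen2]; simp add: A_def \<eta>_def; blast?)+
    note cz = this
    define u1 u2 m1 m2 where "u1 k = avg G1 (\<lambda>i. U (y i) (z k))" and "u2 i = avg G2 (\<lambda>k. U (y i) (z k))"
      and "m1 v = avg G1 (\<lambda>i. y i \<bullet> v)" and "m2 v = avg G2 (\<lambda>k. v \<bullet> z k)" for i k and v :: "real ^ 'm"
    define ph ps where "ph = avg G2 (\<lambda>k. \<phi> (z k))" and "ps = avg G1 (\<lambda>i. \<psi> (y i))"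
    have bu1: "\<bar>u1 k\<bar> \<le> \<delta>" if "k \<in> G2" for k unfolding u1_def using avgU[OF cy(1) z1[OF that]] by simp
    have bu2: "\<bar>u2 i\<bar> \<le> \<delta>" if "i \<in> G1" for i unfolding u2_def using avgU[OF cz(1) y1[OF that]] by simp
    have bm1: "\<bar>m1 v\<bar> \<le> \<delta>" if "norm v = 1" for v unfolding m1_def using avgI[OF cy(2) that] by simp
    have bm2: "\<bar>m2 v\<bar> \<le> \<delta>" if "norm v = 1" for v unfolding m2_def using avgI[OF cz(2) that] by simp
    have bph: "\<bar>ph\<bar> \<le> \<delta>" using cz(3) by (simp add: ph_def nearly_centred_def)
    have bps: "\<bar>ps\<bar> \<le> \<delta>" using cy(3) by (simp add: ps_def nearly_centred_def)
    define M1 M2 M12 u where "M1 = avg G1 (\<lambda>i. m1 (y i))" and "M2 = avg G2 (\<lambda>k. m2 (z k))"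
      and "M12 = avg G2 (\<lambda>k. m1 (z k))" and "u = avg G1 u2"
    have u_eq: "u = avg G2 u1" unfolding u_def u1_def u2_def by (rule avg_swap)
    have bM: "\<bar>M1\<bar> \<le> \<delta>" "\<bar>M2\<bar> \<le> \<delta>" "\<bar>M12\<bar> \<le> \<delta>" "\<bar>u\<bar> \<le> \<delta>"
      unfolding M1_def M2_def M12_def u_def
      by (intro abs_avg_le bm1 bm2 bu2 y1 z1 less_imp_le[OF \<delta>(1)]; assumption)+
    \<comment> \<open>The shift \<open>k1\<close> is dictated by the balance condition, where \<open>er\<close> collects the sample averages;
      \<open>k2\<close> is just large enough to keep \<open>k1\<close> above \<open>\<rho> * \<gamma>\<close>.\<close>
    define k2 where "k2 = \<gamma> + C * \<delta>"
    define er where "er = \<rho> * D * (m1 e + m2 e) + 2 * M1 - 2 * \<rho> * M2 - 4 * M12 + ps - \<rho> * ph - (1 + \<rho>) * u"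
    define k1 where "k1 = \<rho> * k2 + er"
    have scale: "\<bar>q * v\<bar> \<le> q * \<delta>" if "0 \<le> q" "\<bar>v\<bar> \<le> \<delta>" for q v
      using that by (simp add: abs_mult mult_left_mono)
    have er: "\<bar>er\<bar> \<le> C * \<delta>"
    proof -
      have b: "\<bar>\<rho> * D * m1 e\<bar> \<le> \<rho> * D * \<delta>" "\<bar>\<rho> * D * m2 e\<bar> \<le> \<rho> * D * \<delta>"
        "\<bar>2 * \<rho> * M2\<bar> \<le> 2 * \<rho> * \<delta>" "\<bar>\<rho> * ph\<bar> \<le> \<rho> * \<delta>" "\<bar>(1 + \<rho>) * u\<bar> \<le> (1 + \<rho>) * \<delta>"
        using \<rho> D bm1[OF e] bm2[OF e] bM bph by (intro scale; simp)+
      have "C * \<delta> = 2 * (\<rho> * D * \<delta>) + 4 * (\<rho> * \<delta>) + 8 * \<delta>"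
        by (simp add: C_def algebra_simps)
      moreover have "2 * \<rho> * \<delta> = 2 * (\<rho> * \<delta>)" "(1 + \<rho>) * \<delta> = \<delta> + \<rho> * \<delta>"
        "\<rho> * D * (m1 e + m2 e) = \<rho> * D * m1 e + \<rho> * D * m2 e"
        by (simp_all add: algebra_simps)
      moreover note b[THEN abs_le_D1] b[THEN abs_le_D2] bM[THEN abs_le_D1] bM[THEN abs_le_D2]
        bps[THEN abs_le_D1] bps[THEN abs_le_D2]
      ultimately show ?thesis unfolding er_def by (intro abs_leI) linarith+
    qed
    have k: "\<rho> * \<gamma> \<le> k1" "0 \<le> k2" "k1 + k2 \<le> sl + (\<rho> + 2) * C * \<delta>"
    proof -
      have "C * \<delta> \<le> \<rho> * (C * \<delta>)" using mult_right_mono[OF \<rho>, of "C * \<delta>"] C \<delta> by simp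
      moreover have "k1 = \<rho> * \<gamma> + \<rho> * (C * \<delta>) + er" by (simp add: k1_def k2_def algebra_simps)
      moreover have "(\<rho> + 2) * C * \<delta> = \<rho> * (C * \<delta>) + 2 * (C * \<delta>)" "(1 + \<rho>) * \<gamma> = \<gamma> + \<rho> * \<gamma>"
        by (simp_all add: algebra_simps)
      moreover have "0 \<le> C * \<delta>" using C \<delta> by simp
      ultimately show "\<rho> * \<gamma> \<le> k1" "0 \<le> k2" "k1 + k2 \<le> sl + (\<rho> + 2) * C * \<delta>"
        using er[THEN abs_le_D1] er[THEN abs_le_D2] \<gamma> unfolding sl_def[symmetric] k2_def by linarith+
    qed
    define r where "r = 1 / \<rho>"
    have r: "0 < r" "r \<le> 1" "\<rho> * r = 1" "r * \<rho> = 1" using \<rho> by (simp_all add: r_def)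
    have ratio: "real (card G1) / real (card G2) = r" "real (card G2) / real (card G1) = \<rho>"
      using card apos \<rho> by (simp_all add: r_def)
    define X1 where "X1 i k = 2 * (\<rho> - 1) + \<rho> * D * (1 - y i \<bullet> e) + \<rho> * (U (y i) (z k) + \<phi> (z k)) + k1" for i k
    define X2 where "X2 i k = D * (1 + z k \<bullet> e) + r * (- 4 * (y i \<bullet> z k) + \<psi> (y i) - U (y i) (z k)) + k2" for i k
    have X1_row: "avg G2 (X1 i) = 2 * (\<rho> - 1) + \<rho> * D * (1 - y i \<bullet> e) + \<rho> * (u2 i + ph) + k1" for i
      unfolding X1_def avgs u2_def ph_def ..
    have X1_col: "avg G1 (\<lambda>i. X1 i k) = 2 * (\<rho> - 1) + \<rho> * D * (1 - m1 e) + \<rho> * (u1 k + \<phi> (z k)) + k1" for k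
      unfolding X1_def avgs u1_def m1_def ..
    have X2_row: "avg G2 (X2 i) = D * (1 + m2 e) + r * (- 4 * m2 (y i) + \<psi> (y i) - u2 i) + k2" for i
      unfolding X2_def avgs u2_def m2_def inner_commute[of e] ..
    have X2_col: "avg G1 (\<lambda>i. X2 i k) = D * (1 + z k \<bullet> e) + r * (- 4 * m1 (z k) + ps - u1 k) + k2" for k
      unfolding X2_def avgs u1_def m1_def ps_def ..
    have same: "(norm (a - b))\<^sup>2 = 2 - 2 * (a \<bullet> b)" if "norm a = 1" "norm b = 1" for a b :: "real ^ 'm"
      using that by (simp add: power2_norm_eq_inner inner_diff_left inner_diff_right inner_commute norm_eq_1)
    have d1: "avg G1 (\<lambda>j. (norm (x i - x j))\<^sup>2) = 2 - 2 * m1 (y i)" if "i \<in> G1" for i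
    proof -
      have "avg G1 (\<lambda>j. (norm (x i - x j))\<^sup>2) = avg G1 (\<lambda>j. 2 - 2 * (y j \<bullet> y i))"
        using same[OF y1[OF that] y1] by (intro avg_cong) (simp add: y_def inner_commute)
      then show ?thesis by (simp add: avgs m1_def)
    qed
    have d2: "avg G2 (\<lambda>l. (norm (x k - x l))\<^sup>2) = 2 - 2 * m2 (z k)" if "k \<in> G2" for k
    proof -
      have "avg G2 (\<lambda>l. (norm (x k - x l))\<^sup>2) = avg G2 (\<lambda>l. 2 - 2 * (z k \<bullet> z l))"
        using same[OF z1[OF that] z1] by (intro avg_cong) (simp add: z_def)
      then show ?thesis by (simp add: avgs m2_def)
    qed
    have d12: "(norm (x i - x k))\<^sup>2 = \<Delta>\<^sup>2 + 2 - 2 * \<Delta> * (y i \<bullet> e - z k \<bullet> e) - 2 * (y i \<bullet> z k)"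
      if "i \<in> G1" "k \<in> G2" for i k
    proof -
      have "x i - x k = y i - z k - (c2 - c1)" by (simp add: y_def z_def)
      also have "\<dots> = y i - z k - \<Delta> *\<^sub>R e" by (simp only: c)
      finally have eq: "x i - x k = y i - z k - \<Delta> *\<^sub>R e" .
      show ?thesis
        unfolding eq power2_norm_eq_inner
        using y1[OF that(1)] z1[OF that(2)] e
        by (simp add: inner_diff_left inner_diff_right inner_commute norm_eq_1 algebra_simps power2_eq_square)
    qed
    show ?thesis
    proof (rule lp2_recovers_if_certificate[OF part n, where V = X1 and W = X2])
      fix i k assume ik: "i \<in> G1" "k \<in> G2"
      have "\<rho> * (- \<gamma>) \<le> \<rho> * (D * (1 - y i \<bullet> e) + U (y i) (z k) + \<phi> (z k))"
        using lower[OF y1[OF ik(1)] z1[OF ik(2)]] \<rho> by (intro mult_left_mono) auto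
      then have "- (\<rho> * \<gamma>) \<le> \<rho> * D * (1 - y i \<bullet> e) + \<rho> * (U (y i) (z k) + \<phi> (z k))"
        by (simp add: algebra_simps)
      moreover have "0 \<le> 2 * (\<rho> - 1)" using \<rho> by simp
      moreover have "0 \<le> q + a + b + k1" if "- (\<rho> * \<gamma>) \<le> a + b" "0 \<le> q" for q a b
        using that k(1) by linarith
      ultimately show "0 \<le> X1 i k" unfolding X1_def by blast
      have "0 \<le> r * (\<rho> * D * (1 + z k \<bullet> e) - 4 * (y i \<bullet> z k) + \<psi> (y i) - U (y i) (z k))"
        using upper[OF y1[OF ik(1)] z1[OF ik(2)]] r by (intro mult_nonneg_nonneg) auto
      also have "\<dots> = (r * \<rho>) * D * (1 + z k \<bullet> e) + r * (- 4 * (y i \<bullet> z k) + \<psi> (y i) - U (y i) (z k))"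
        by (simp only: algebra_simps)
      finally show "0 \<le> X2 i k" using k(2) r unfolding X2_def by simp
      let ?t = "y i \<bullet> e" and ?t' = "- (z k \<bullet> e)" and ?U = "U (y i) (z k)"
      let ?err = "D * m1 e - \<rho> * D * m2 e + \<rho> * (u2 i + ph) + r * (- 4 * m1 (z k) + ps - u1 k) - u1 k + 4 * m2 (y i) + u2 i"
      have "avg G2 (X1 i) + avg G1 (\<lambda>i. X2 i k) + r * (X1 i k - avg G1 (\<lambda>i. X1 i k)) + \<rho> * (X2 i k - avg G2 (X2 i))
        = 2 * (\<rho> - 1) + (1 + \<rho>) * D * (1 - ?t - ?t') - 4 * (y i \<bullet> z k) + ?err + k1 + k2"
      proof -
        have 1: "r * (X1 i k - avg G1 (\<lambda>i. X1 i k)) = (r * \<rho>) * (D * (m1 e - ?t) + ?U - u1 k)"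
          unfolding X1_col by (simp add: X1_def algebra_simps)
        have 2: "\<rho> * (X2 i k - avg G2 (X2 i)) = \<rho> * D * (- ?t' - m2 e) + (\<rho> * r) * (- 4 * (y i \<bullet> z k) + 4 * m2 (y i) - ?U + u2 i)"
          unfolding X2_row by (simp add: X2_def algebra_simps)
        show ?thesis
          unfolding 1 2 r X1_row X2_col by (simp add: algebra_simps)
      qed
      also have "\<dots> < 2 * ((norm (x i - x k))\<^sup>2 - (2 - 2 * m1 (y i)) - (2 - 2 * m2 (z k)))"
      proof -
        have 3: "\<bar>D * m1 e\<bar> \<le> D * \<delta>" "\<bar>\<rho> * D * m2 e\<bar> \<le> \<rho> * D * \<delta>" "\<bar>\<rho> * u2 i\<bar> \<le> \<rho> * \<delta>" "\<bar>\<rho> * ph\<bar> \<le> \<rho> * \<delta>"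
          "\<bar>r * m1 (z k)\<bar> \<le> r * \<delta>" "\<bar>r * ps\<bar> \<le> r * \<delta>" "\<bar>r * u1 k\<bar> \<le> r * \<delta>"
          using \<rho> D r bm1[OF e] bm2[OF e] bm1[OF z1[OF ik(2)]] bu1[OF ik(2)] bu2[OF ik(1)] bph bps by (intro scale; simp)+
        have 4: "r * \<delta> \<le> \<delta>" using r \<delta> by (simp add: mult_le_cancel_right2)
        have 5: "C2 * \<delta> = (\<rho> + 2) * C * \<delta> + 2 * (\<rho> * \<delta>) + 20 * \<delta> + D * \<delta> + \<rho> * D * \<delta>"
          by (simp add: C2_def algebra_simps)
        have 6: "\<rho> * (u2 i + ph) = \<rho> * u2 i + \<rho> * ph" "r * (- 4 * m1 (z k) + ps - u1 k) = - 4 * (r * m1 (z k)) + r * ps - r * u1 k"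
          by (simp_all add: algebra_simps)
        note bounds = bm1[OF y1[OF ik(1)]] bm2[OF y1[OF ik(1)]] bm2[OF z1[OF ik(2)]] bu1[OF ik(2)] bu2[OF ik(1)]
        have "?err - 4 * m1 (y i) - 4 * m2 (z k) + k1 + k2 \<le> sl + C2 * \<delta>"
          unfolding 5 6
          using 3[THEN abs_le_D1] 3[THEN abs_le_D2] bounds[THEN abs_le_D1] bounds[THEN abs_le_D2] 4 k(3)
          by linarith
        then have 7: "?err - 4 * m1 (y i) - 4 * m2 (z k) + k1 + k2 < 2 * sl" using \<delta>(2) by simp
        have "?t \<le> 1" "?t' \<le> 1"
          using Cauchy_Schwarz_ineq2[of "y i" e] Cauchy_Schwarz_ineq2[of "z k" e] y1[OF ik(1)] z1[OF ik(2)] e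
          by (auto simp: abs_le_iff)
        then have "(\<Delta> - \<Delta>0) * (\<Delta> + \<Delta>0 - 4) \<le> (\<Delta> - \<Delta>0) * (\<Delta> + \<Delta>0 - 2 * (?t + ?t'))"
          using \<Delta> by (intro mult_left_mono) auto
        then have 8: "sl \<le> \<Delta>\<^sup>2 - \<Delta>0\<^sup>2 - 2 * (\<Delta> - \<Delta>0) * (?t + ?t')"
          unfolding sl_def by (simp add: algebra_simps power2_eq_square)
        have 9: "(1 + \<rho>) * D * (1 - ?t - ?t') = 4 * \<Delta>0 - 4 * \<Delta>0 * (?t + ?t')"
          unfolding \<Delta>0(1) by (simp add: algebra_simps)
        show ?thesis unfolding 9 d12[OF ik] using 7 8 \<Delta>0(2) by (simp add: algebra_simps)
      qed
      finally show "avg G2 (X1 i) + avg G1 (\<lambda>i. X2 i k)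
           + real (card G1) / real (card G2) * (X1 i k - avg G1 (\<lambda>i. X1 i k))
           + real (card G2) / real (card G1) * (X2 i k - avg G2 (X2 i))
         < 2 * ((norm (x i - x k))\<^sup>2 - avg G1 (\<lambda>j. (norm (x i - x j))\<^sup>2) - avg G2 (\<lambda>j. (norm (x k - x j))\<^sup>2))"
        unfolding ratio d1[OF ik(1)] d2[OF ik(2)] .
    next
      have sum_avg: "(\<Sum>i\<in>S. f i) = real (card S) * avg S f" if "finite S" "S \<noteq> {}" for S :: "nat set" and f
        using that by (simp add: avg_def)
      have "(\<Sum>i\<in>G1. avg G1 (\<lambda>j. (norm (x i - x j))\<^sup>2) + avg G2 (X1 i))
          = (\<Sum>i\<in>G1. (2 - 2 * m1 (y i)) + (2 * (\<rho> - 1) + \<rho> * D * (1 - y i \<bullet> e) + \<rho> * (u2 i + ph) + k1))"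
        by (intro sum.cong refl) (simp add: d1 X1_row)
      also have "\<dots> = real (card G1) * (2 - 2 * M1 + (2 * (\<rho> - 1) + \<rho> * D * (1 - m1 e) + \<rho> * (u + ph) + k1))"
        unfolding sum_avg[OF fin(1) ne(1)] avgs M1_def u_def m1_def ..
      finally have L: "(\<Sum>i\<in>G1. avg G1 (\<lambda>j. (norm (x i - x j))\<^sup>2) + avg G2 (X1 i)) = \<dots>" .
      have "(\<Sum>k\<in>G2. avg G2 (\<lambda>j. (norm (x k - x j))\<^sup>2) + avg G1 (\<lambda>i. X2 i k))
          = (\<Sum>k\<in>G2. (2 - 2 * m2 (z k)) + (D * (1 + z k \<bullet> e) + r * (- 4 * m1 (z k) + ps - u1 k) + k2))"
        by (intro sum.cong refl) (simp add: d2 X2_col)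
      also have "\<dots> = real (card G2) * (2 - 2 * M2 + (D * (1 + m2 e) + r * (- 4 * M12 + ps - u) + k2))"
        unfolding sum_avg[OF fin(2) ne(2)] avgs M2_def u_eq m2_def M12_def inner_commute[of e] ..
      also have "\<dots> = real (card G1) * (\<rho> * (2 - 2 * M2 + D * (1 + m2 e) + k2) + (\<rho> * r) * (- 4 * M12 + ps - u))"
        unfolding card by (simp add: algebra_simps)
      also have "\<dots> = real (card G1) * (2 - 2 * M1 + (2 * (\<rho> - 1) + \<rho> * D * (1 - m1 e) + \<rho> * (u + ph) + k1))"
        unfolding r k1_def er_def by (simp add: algebra_simps)
      finally show "(\<Sum>i\<in>G1. avg G1 (\<lambda>j. (norm (x i - x j))\<^sup>2) + avg G2 (X1 i))
        = (\<Sum>k\<in>G2. avg G2 (\<lambda>j. (norm (x k - x j))\<^sup>2) + avg G1 (\<lambda>i. X2 i k))"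
        unfolding L by simp
    qed
  qed
  then show ?thesis
    using A1 A2 \<phi> \<psi> \<delta> by (intro exI[of _ A] exI[of _ \<eta>]) (auto simp: A_def \<eta>_def)
qed

section \<open>Construction of the kernel\<close>

text \<open>
  With \<open>D = 4 / (s - 1)\<close> one has \<open>\<rho> * D = 16 / D + 8 - D\<close>, and \<open>D \<ge> 4\<close> means \<open>\<rho> \<le> 2\<close>. For \<open>\<epsilon> = 0\<close> the
  function \<open>b\<close> is linear, and at \<open>t = t' = 1\<close> the product of the two right-hand sides is at most
  \<open>(8 / D + 2)\<^sup>2\<close>, while that of the left-hand sides is 16. This rules out \<open>D > 4\<close>; a cubic correction
  that vanishes at \<open>0\<close> and \<open>\<plusminus> 1\<close> is enough to repair it.
\<close>

lemma kernel_parameters: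
  fixes D :: real
  assumes D: "0 < D" "D\<^sup>2 \<le> 4 * D + 8"
  defines "b \<equiv> \<lambda>\<epsilon> t :: real. t - \<epsilon> * t * (1 - t\<^sup>2)"
  obtains f g \<epsilon> \<kappa> :: real where "f + g = 4" "0 < \<kappa>"
    "\<And>t t'. \<bar>t\<bar> \<le> 1 \<Longrightarrow> \<bar>t'\<bar> \<le> 1 \<Longrightarrow> \<kappa> * (1 + t) \<le> D - f * b \<epsilon> t' + g * \<epsilon> * t * t' * (1 + t)"
    "\<And>t t'. \<bar>t\<bar> \<le> 1 \<Longrightarrow> \<bar>t'\<bar> \<le> 1 \<Longrightarrow> 4 / \<kappa> * (1 + t') \<le> 16 / D + 8 - D - g * b \<epsilon> t + f * \<epsilon> * t * t' * (1 + t')"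
proof (cases "4 \<le> D")
  case True
  define \<kappa> where "\<kappa> = D / 2 - 3 / 5"
  have D2: "D < 547 / 100"
  proof (rule ccontr)
    assume "\<not> D < 547 / 100"
    then have "(547/100 - 4) * (547/100) \<le> (D - 4) * D" by (intro mult_mono) auto
    then show False using D by (simp add: algebra_simps power2_eq_square)
  qed
  have \<kappa>: "7/5 \<le> \<kappa>" "\<kappa> < 107 / 50" using True D2 by (simp_all add: \<kappa>_def)
  \<comment> \<open>Both right-hand sides are smallest where the argument of \<open>b\<close> is 1.\<close>
  have drop: "2 * b (1/5) u - 2/5 * w * u * (1 + w) \<le> 2 - 2/5 * w * (1 + w)" if "\<bar>u\<bar> \<le> 1" "\<bar>w\<bar> \<le> 1" for u w :: real
  proof -
    have "0 \<le> (1 - w) * (2 + w)" using that by (intro mult_nonneg_nonneg) auto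
    then have "w * (1 + w) \<le> 2" by (simp add: algebra_simps)
    moreover have "-1 \<le> u + u\<^sup>2" using zero_le_power2[of "u + 1/2"] by (simp add: power2_eq_square algebra_simps)
    moreover have "0 \<le> 2 + 2/5 * p - 2/5 * q" if "q \<le> 2" "-1 \<le> p" for p q :: real using that by linarith
    ultimately have "0 \<le> 2 + 2/5 * (u + u\<^sup>2) - 2/5 * (w * (1 + w))" by blast
    then have "0 \<le> (1 - u) * (2 + 2/5 * (u + u\<^sup>2) - 2/5 * (w * (1 + w)))"
      using that by (intro mult_nonneg_nonneg) auto
    then show ?thesis by (simp add: b_def field_simps power2_eq_square)
  qed
  show ?thesis
  proof (rule that[of 2 2 \<kappa> "1/5"])
    fix t t' :: real assume t: "\<bar>t\<bar> \<le> 1" "\<bar>t'\<bar> \<le> 1"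
    have "0 \<le> (1 - t) * (D / 2 - 7/5 - 2/5 * t)" using t True by (intro mult_nonneg_nonneg) auto
    then show "\<kappa> * (1 + t) \<le> D - 2 * b (1/5) t' + 2 * (1/5) * t * t' * (1 + t)"
      using drop[OF t(2,1)] by (simp add: \<kappa>_def field_simps)
    define q where "q = 4 / \<kappa>"
    have q: "6/5 \<le> q" using \<kappa> by (simp add: q_def field_simps)
    have "0 \<le> (D - 4) * (547/100 - D) * (5 * D - 6)" "0 \<le> (D - 4) * (547/100 - D)"
      using True D2 by simp_all
    \<comment> \<open>A certificate of positivity for this cubic on the interval \<open>[4, 5.47]\<close>.\<close>
    moreover have "(16 + 34/5 * D - D * D) * (5 * D - 6) - 80 * D
        = (D - 4) * (547/100 - D) * (5 * D - 6) + 267/20 * ((D - 4) * (547/100 - D)) + (64818/1000 - 10045/10000 * D)"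
      by (simp add: field_simps)
    ultimately have "80 * D \<le> (16 + 34/5 * D - D * D) * (5 * D - 6)"
      using D2 by linarith
    then have "8 / \<kappa> \<le> 16 / D + 34/5 - D"
      using True by (simp add: \<kappa>_def field_simps)
    moreover define r where "r = 16 / D + 8 - D"
    ultimately have "2 * q \<le> r - 6/5" by (simp add: q_def)
    moreover have "0 \<le> (1 - t') * (q - 4/5 - 2/5 * t')" using t q by (intro mult_nonneg_nonneg) auto
    ultimately have "q * (1 + t') \<le> r - 2 * b (1/5) t + 2 * (1/5) * t * t' * (1 + t')"
      using drop[OF t] by (simp add: field_simps)
    then show "4 / \<kappa> * (1 + t') \<le> 16 / D + 8 - D - 2 * b (1/5) t + 2 * (1/5) * t * t' * (1 + t')"
      by (simp add: q_def r_def)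
  qed (use \<kappa> in auto)
next
  case False
  show ?thesis
  proof (rule that[of 0 4 "D / 2" 0])
    fix t t' :: real assume t: "\<bar>t\<bar> \<le> 1" "\<bar>t'\<bar> \<le> 1"
    show "D / 2 * (1 + t) \<le> D - 0 * b 0 t' + 4 * 0 * t * t' * (1 + t)"
      using t D mult_left_mono[of "1 + t" 2 "D / 2"] by simp
    have "8 / D * (1 + t') \<le> 8 / D * 2" using t D by (intro mult_left_mono) auto
    then show "4 / (D / 2) * (1 + t') \<le> 16 / D + 8 - D - 4 * b 0 t + 0 * 0 * t * t' * (1 + t')"
      using t False by (simp add: b_def)
  qed (use D in auto)
qed

text \<open>
  Let \<open>t = y \<bullet> e\<close>, \<open>t' = - (z \<bullet> e)\<close>, and let \<open>perp\<close> be the projection to the orthogonal complement of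
  \<open>e\<close>, so that \<open>y \<bullet> z = perp y \<bullet> perp z - t * t'\<close>. The functions \<open>\<phi>\<close> and \<open>\<psi>\<close> are multiples of
  \<open>b \<epsilon> t'\<close> and \<open>b \<epsilon> t\<close>. The part \<open>R\<close> of the kernel depends on \<open>t\<close> and \<open>t'\<close> only; it makes the first
  inequality an equality at \<open>t = 1\<close> and the second one at \<open>t' = 1\<close>, as the vanishing averages force it
  to do. By the choice of parameters these inequalities then hold with the margins
  \<open>\<kappa> * (1 - t\<^sup>2) = \<kappa> * (norm (perp y))\<^sup>2\<close> and \<open>4 / \<kappa> * (norm (perp z))\<^sup>2\<close>.

  It remains to split \<open>4 * (perp y \<bullet> perp z)\<close> between the two inequalities within these margins, whose
  sum suffices by the inequality of arithmetic and geometric means. The fraction that is taken by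
  the first inequality is \<open>\<sigma> / (\<sigma> + 4 / \<kappa>\<^sup>2 * (norm (perp z))\<^sup>2)\<close>, and \<open>W\<close> is minus this part. Here \<open>\<sigma>\<close>
  should be \<open>(norm (perp y))\<^sup>2\<close>; replacing it by the next larger multiple of \<open>1 / N\<close> turns \<open>W\<close> into a finite sum of
  products, at the expense of the error \<open>\<gamma>\<close>.
\<close>

lemma exists_kernel:
  fixes e :: "real ^ 'm"
  assumes e: "norm e = 1" and D: "0 < D" "D\<^sup>2 \<le> 4 * D + 8" and \<gamma>: "0 < \<gamma>"
  obtains U :: "real ^ 'm \<Rightarrow> real ^ 'm \<Rightarrow> real" and \<phi> \<psi> :: "real ^ 'm \<Rightarrow> real" where
    "odd_kernel U" "odd_bounded \<phi>" "odd_bounded \<psi>"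
    "\<And>y z. norm y = 1 \<Longrightarrow> norm z = 1 \<Longrightarrow> - \<gamma> \<le> D * (1 - y \<bullet> e) + U y z + \<phi> z"
    "\<And>y z. norm y = 1 \<Longrightarrow> norm z = 1 \<Longrightarrow>
       0 \<le> (16 / D + 8 - D) * (1 + z \<bullet> e) - 4 * (y \<bullet> z) + \<psi> y - U y z"
proof -
  define b where "b \<epsilon> t = t - \<epsilon> * t * (1 - t\<^sup>2)" for \<epsilon> t :: real
  obtain f g \<epsilon> \<kappa> where fg: "f + g = 4" and \<kappa>: "0 < \<kappa>"
    and K1: "\<And>t t'. \<bar>t\<bar> \<le> 1 \<Longrightarrow> \<bar>t'\<bar> \<le> 1 \<Longrightarrow> \<kappa> * (1 + t) \<le> D - f * b \<epsilon> t' + g * \<epsilon> * t * t' * (1 + t)"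
    and K2: "\<And>t t'. \<bar>t\<bar> \<le> 1 \<Longrightarrow> \<bar>t'\<bar> \<le> 1 \<Longrightarrow> 4 / \<kappa> * (1 + t') \<le> 16 / D + 8 - D - g * b \<epsilon> t + f * \<epsilon> * t * t' * (1 + t')"
    using kernel_parameters[OF D] unfolding b_def by metis
  obtain N0 where N0: "1 / real (Suc N0) < \<gamma> / \<kappa>"
    using nat_approx_posE[of "\<gamma> / \<kappa>"] \<gamma> \<kappa> by auto
  define N where "N = Suc N0"
  have N: "N > 0" "\<kappa> / real N \<le> \<gamma>" using N0 \<kappa> by (simp_all add: N_def field_simps)
  define perp where "perp y = y - (y \<bullet> e) *\<^sub>R e" for y :: "real ^ 'm"
  define \<sigma> where "\<sigma> l = real (Suc l) / real N" for l
  define cls where "cls y = nat \<lfloor>real N * (norm (perp y))\<^sup>2\<rfloor>" for y :: "real ^ 'm"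
  define R where "R y z = f * (y \<bullet> e) * b \<epsilon> (- (z \<bullet> e)) + g * ((y \<bullet> e) - b \<epsilon> (y \<bullet> e)) * (- (z \<bullet> e))" for y z :: "real ^ 'm"
  define W where "W y z = (\<Sum>l\<le>N. \<Sum>v\<in>Basis. (if cls y = l then - 4 * (perp y \<bullet> v) else 0)
      * ((perp z \<bullet> v) * (\<sigma> l / (\<sigma> l + 4 / \<kappa>\<^sup>2 * (norm (perp z))\<^sup>2))))" for y z
  have [measurable]: "perp \<in> borel_measurable borel" unfolding perp_def by measurable
  have [measurable]: "b \<epsilon> \<in> borel_measurable borel" unfolding b_def by measurable
  have ee: "e \<bullet> e = 1" using e by (simp add: norm_eq_1)
  have pm: "perp (- y) = - perp y" for y by (simp add: perp_def)
  have ip: "perp y \<bullet> perp z = y \<bullet> z - (y \<bullet> e) * (z \<bullet> e)" for y z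
    by (simp add: perp_def inner_diff_left inner_diff_right ee inner_commute)
  have np: "(norm (perp y))\<^sup>2 = 1 - (y \<bullet> e)\<^sup>2" if "norm y = 1" for y
    using that unfolding power2_norm_eq_inner ip norm_eq_1 by (simp add: power2_eq_square)
  have t1: "\<bar>y \<bullet> e\<bar> \<le> 1" if "norm y = 1" for y
    using Cauchy_Schwarz_ineq2[of y e] that e by simp
  have np1: "norm (perp y) \<le> 1" if "norm y = 1" for y
    by (rule power2_le_imp_le) (use np[OF that] in auto)
  have bm: "b \<epsilon> (- t) = - b \<epsilon> t" for t by (simp add: b_def)
  have bb: "\<bar>b \<epsilon> t\<bar> \<le> 1 + \<bar>\<epsilon>\<bar>" if "\<bar>t\<bar> \<le> 1" for t
  proof -
    have "\<bar>t * (1 - t\<^sup>2)\<bar> \<le> 1 * 1" using that by (subst abs_mult, intro mult_mono) (auto simp: abs_square_le_1 abs_le_iff)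
    then have "\<bar>\<epsilon> * (t * (1 - t\<^sup>2))\<bar> \<le> \<bar>\<epsilon>\<bar> * 1" unfolding abs_mult[of \<epsilon>] by (intro mult_left_mono) auto
    then show ?thesis using that by (simp add: b_def mult.assoc)
  qed
  have odd_b: "odd_bounded (\<lambda>y. q * b \<epsilon> (y \<bullet> e))" for q
    unfolding odd_bounded_def
    by (auto simp: bm abs_mult intro!: exI[of _ "\<bar>q\<bar> * (1 + \<bar>\<epsilon>\<bar>)"] mult_left_mono bb t1)
  have odd_t: "odd_bounded (\<lambda>y. q * (y \<bullet> e))" for q
    unfolding odd_bounded_def
    by (auto simp: abs_mult intro!: exI[of _ "\<bar>q\<bar> * 1"] mult_left_mono t1)
  have odd_tb: "odd_bounded (\<lambda>y. q * ((y \<bullet> e) - b \<epsilon> (y \<bullet> e)))" for q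
    unfolding odd_bounded_def
  proof (intro conjI allI exI[of _ "\<bar>q\<bar> * (2 + \<bar>\<epsilon>\<bar>)"] impI)
    fix y :: "real ^ 'm" assume "norm y = 1"
    from bb[OF t1[OF this]] t1[OF this] have "\<bar>(y \<bullet> e) - b \<epsilon> (y \<bullet> e)\<bar> \<le> 2 + \<bar>\<epsilon>\<bar>" by linarith
    then show "\<bar>q * ((y \<bullet> e) - b \<epsilon> (y \<bullet> e))\<bar> \<le> \<bar>q\<bar> * (2 + \<bar>\<epsilon>\<bar>)"
      unfolding abs_mult by (intro mult_left_mono) auto
  qed (auto simp: bm algebra_simps)
  have odd_class: "odd_bounded (\<lambda>y. if cls y = l then - 4 * (perp y \<bullet> v) else 0)" if "v \<in> Basis" for l v
    unfolding odd_bounded_def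
  proof (intro conjI allI exI[of _ 4] impI)
    show "(\<lambda>y. if cls y = l then - 4 * (perp y \<bullet> v) else 0) \<in> borel_measurable borel"
      unfolding cls_def by measurable
    show "(if cls (- y) = l then - 4 * (perp (- y) \<bullet> v) else 0) = - (if cls y = l then - 4 * (perp y \<bullet> v) else 0)" for y
      by (simp add: cls_def pm)
    show "\<bar>if cls y = l then - 4 * (perp y \<bullet> v) else 0\<bar> \<le> 4" if "norm y = 1" for y
      using Basis_le_norm[OF \<open>v \<in> Basis\<close>, of "perp y"] np1[OF that] by (simp add: abs_mult)
  qed
  have \<sigma>pos: "0 < \<sigma> l" for l using N by (simp add: \<sigma>_def)
  have odd_weight: "odd_bounded (\<lambda>z. (perp z \<bullet> v) * (\<sigma> l / (\<sigma> l + 4 / \<kappa>\<^sup>2 * (norm (perp z))\<^sup>2)))" if "v \<in> Basis" for l v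
    unfolding odd_bounded_def
  proof (intro conjI allI exI[of _ 1] impI)
    fix z :: "real ^ 'm" assume z: "norm z = 1"
    have "\<bar>\<sigma> l / (\<sigma> l + 4 / \<kappa>\<^sup>2 * (norm (perp z))\<^sup>2)\<bar> \<le> 1"
      using \<sigma>pos[of l] by (simp add: abs_divide add_pos_nonneg)
    moreover have "\<bar>perp z \<bullet> v\<bar> \<le> 1" using Basis_le_norm[OF that, of "perp z"] np1[OF z] by simp
    ultimately show "\<bar>(perp z \<bullet> v) * (\<sigma> l / (\<sigma> l + 4 / \<kappa>\<^sup>2 * (norm (perp z))\<^sup>2))\<bar> \<le> 1"
      unfolding abs_mult by (intro mult_le_one) auto
  qed (auto simp: pm)
  have kW: "odd_kernel W"
    unfolding W_def by (intro odd_kernel_sum odd_kernel.prod odd_class odd_weight) auto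
  have odd_mt: "odd_bounded (\<lambda>z. - (z \<bullet> e))" using odd_t[of "-1"] by simp
  have odd_mb: "odd_bounded (\<lambda>z. b \<epsilon> (- (z \<bullet> e)))" using odd_b[of "-1"] by (simp add: bm)
  have kR: "odd_kernel R"
    unfolding R_def by (intro odd_kernel.add odd_kernel.prod odd_t odd_tb odd_mt odd_mb)
  have W_eq: "W y z = - (4 * (perp y \<bullet> perp z) * (\<sigma> (cls y) / (\<sigma> (cls y) + 4 / \<kappa>\<^sup>2 * (norm (perp z))\<^sup>2)))"
    if y: "norm y = 1" for y z
  proof -
    have "real N * (norm (perp y))\<^sup>2 \<le> real N * 1" using np1[OF y] by (intro mult_left_mono) (auto simp: abs_square_le_1)
    then have cls: "cls y \<le> N" unfolding cls_def by linarith
    define h where "h l = \<sigma> l / (\<sigma> l + 4 / \<kappa>\<^sup>2 * (norm (perp z))\<^sup>2)" for l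
    have "W y z = (\<Sum>l\<le>N. if cls y = l then \<Sum>v\<in>Basis. - 4 * (perp y \<bullet> v) * ((perp z \<bullet> v) * h l) else 0)"
      unfolding W_def h_def[symmetric] by (intro sum.cong refl) auto
    also have "\<dots> = (\<Sum>v\<in>Basis. - 4 * (perp y \<bullet> v) * ((perp z \<bullet> v) * h (cls y)))"
      using cls by (simp add: sum.delta')
    also have "\<dots> = - (4 * (\<Sum>v\<in>Basis. (perp y \<bullet> v) * (perp z \<bullet> v)) * h (cls y))"
      by (simp add: sum_distrib_left sum_distrib_right sum_negf mult.assoc)
    finally show ?thesis by (simp add: euclidean_inner[symmetric] h_def)
  qed
  have W_bounds: "- (\<kappa> * (norm (perp y))\<^sup>2 + \<gamma>) \<le> W y z" "4 * (perp y \<bullet> perp z) + W y z \<le> 4 / \<kappa> * (norm (perp z))\<^sup>2"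
    if y: "norm y = 1" for y z
  proof -
    define P a h s where "P = perp y \<bullet> perp z" and "a = (norm (perp y))\<^sup>2" and "h = 4 / \<kappa>\<^sup>2 * (norm (perp z))\<^sup>2" and "s = \<sigma> (cls y)"
    have s: "0 < s" "a \<le> s" "s \<le> a + 1 / real N"
    proof -
      show "0 < s" by (simp add: s_def \<sigma>pos)
      have "real (cls y) = of_int \<lfloor>real N * a\<rfloor>" by (simp add: cls_def a_def)
      then have "real (cls y) \<le> real N * a" "real N * a \<le> real (cls y) + 1" by linarith+
      then show "a \<le> s" "s \<le> a + 1 / real N" using N by (simp_all add: s_def \<sigma>_def field_simps)
    qed
    have h: "0 \<le> h" by (simp add: h_def)
    \<comment> \<open>Both bounds follow from \<open>4 * P \<le> \<kappa> * (s + h)\<close>.\<close>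
    have "0 \<le> (norm (\<kappa> *\<^sub>R perp y - 2 *\<^sub>R perp z))\<^sup>2" by simp
    also have "\<dots> = \<kappa>\<^sup>2 * a - 4 * \<kappa> * P + 4 * (norm (perp z))\<^sup>2"
      unfolding a_def P_def power2_norm_eq_inner
      by (simp add: inner_diff_left inner_diff_right inner_commute power2_eq_square)
    also have "\<dots> = \<kappa> * (\<kappa> * (a + h) - 4 * P)"
      using \<kappa> by (simp add: h_def field_simps power2_eq_square)
    finally have "4 * P \<le> \<kappa> * (a + h)" using \<kappa> by (simp add: zero_le_mult_iff)
    also have "\<dots> \<le> \<kappa> * (s + h)" using \<kappa> s by (intro mult_left_mono) auto
    finally have amgm: "4 * P \<le> \<kappa> * (s + h)" .
    have W: "W y z = - (4 * P * (s / (s + h)))" unfolding W_eq[OF y] P_def s_def h_def ..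
    have "4 * P * (s / (s + h)) \<le> \<kappa> * (s + h) * (s / (s + h))" using amgm s h by (intro mult_right_mono) auto
    also have "\<dots> = \<kappa> * s" using s h by simp
    also have "\<dots> \<le> \<kappa> * (a + 1 / real N)" using s \<kappa> by (intro mult_left_mono) auto
    also have "\<dots> \<le> \<kappa> * a + \<gamma>" using N by (simp add: distrib_left)
    finally show "- (\<kappa> * (norm (perp y))\<^sup>2 + \<gamma>) \<le> W y z" unfolding W a_def by simp
    have "4 * P + W y z = 4 * P * (h / (s + h))" unfolding W using s h by (simp add: field_simps)
    also have "\<dots> \<le> \<kappa> * (s + h) * (h / (s + h))" using amgm s h by (intro mult_right_mono) auto
    also have "\<dots> = \<kappa> * h" using s h by simp
    also have "\<dots> = 4 / \<kappa> * (norm (perp z))\<^sup>2" using \<kappa> by (simp add: h_def power2_eq_square)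
    finally show "4 * (perp y \<bullet> perp z) + W y z \<le> 4 / \<kappa> * (norm (perp z))\<^sup>2" unfolding P_def .
  qed
  show ?thesis
  proof (rule that[of "\<lambda>y z. R y z + W y z" "\<lambda>z. f * b \<epsilon> (z \<bullet> e)" "\<lambda>y. - g * b \<epsilon> (y \<bullet> e)"])
    show "odd_kernel (\<lambda>y z. R y z + W y z)" using kR kW by (rule odd_kernel.add)
    show "odd_bounded (\<lambda>z. f * b \<epsilon> (z \<bullet> e))" "odd_bounded (\<lambda>y. - g * b \<epsilon> (y \<bullet> e))" by (rule odd_b)+
    fix y z :: "real ^ 'm" assume y: "norm y = 1" and z: "norm z = 1"
    define t t' where "t = y \<bullet> e" and "t' = - (z \<bullet> e)"
    have t: "\<bar>t\<bar> \<le> 1" "\<bar>t'\<bar> \<le> 1" using t1[OF y] t1[OF z] by (simp_all add: t_def t'_def)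
    have ze: "z \<bullet> e = - t'" "y \<bullet> e = t" by (simp_all add: t_def t'_def)
    have R: "R y z = f * t * b \<epsilon> t' + g * (t - b \<epsilon> t) * t'" by (simp add: R_def ze)
    have "(1 - t) * (\<kappa> * (1 + t)) \<le> (1 - t) * (D - f * b \<epsilon> t' + g * \<epsilon> * t * t' * (1 + t))"
      using t by (intro mult_left_mono K1) auto
    then have "\<kappa> * (norm (perp y))\<^sup>2 \<le> D * (1 - t) + R y z - f * b \<epsilon> t'"
      unfolding R np[OF y] ze b_def by (simp add: algebra_simps power2_eq_square)
    then show "- \<gamma> \<le> D * (1 - y \<bullet> e) + (R y z + W y z) + f * b \<epsilon> (z \<bullet> e)"
      using W_bounds(1)[OF y, of z] by (simp add: ze bm)
    have "(1 - t') * (4 / \<kappa> * (1 + t')) \<le> (1 - t') * (16 / D + 8 - D - g * b \<epsilon> t + f * \<epsilon> * t * t' * (1 + t'))"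
      using t by (intro mult_left_mono K2) auto
    then have "4 / \<kappa> * (norm (perp z))\<^sup>2
        \<le> (1 - t') * (16 / D + 8 - D) - g * b \<epsilon> t * (1 - t') + f * \<epsilon> * t * t' * (1 + t') * (1 - t')"
      unfolding np[OF z] ze by (simp add: algebra_simps power2_eq_square)
    also have "\<dots> = (16 / D + 8 - D) * (1 + z \<bullet> e) + (f + g) * t * t' - g * b \<epsilon> t - R y z"
      unfolding R ze b_def by (simp add: algebra_simps power2_eq_square)
    finally show "0 \<le> (16 / D + 8 - D) * (1 + z \<bullet> e) - 4 * (y \<bullet> z) + - g * b \<epsilon> (y \<bullet> e) - (R y z + W y z)"
      using W_bounds(2)[OF y, of z] unfolding fg by (simp add: ip ze)
  qed
qed

text \<open>
  Here the threshold enters. With \<open>u = s - 1\<close> the inequality \<open>D\<^sup>2 \<le> 4 * D + 8\<close> reads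
  \<open>2 \<le> u\<^sup>2 + 2 * u\<close>, which is \<open>1 \<le> \<rho>\<close>.
\<close>

lemma recovers_if_nearly_centred:
  fixes e :: "real ^ 'm"
  assumes \<rho>: "1 \<le> \<rho>" and e: "norm e = 1" and \<Delta>: "1 + sqrt (2 + \<rho>) < \<Delta>"
  shows "\<exists>A \<eta>. finite A \<and> (\<forall>\<alpha>\<in>A. odd_bounded \<alpha>) \<and> 0 < \<eta> \<and>
    (\<forall>n G1 G2 c1 c2 x. planted_partition n G1 G2 \<longrightarrow> 3 \<le> n \<longrightarrow> real (card G2) = \<rho> * real (card G1) \<longrightarrow>
       c2 - c1 = \<Delta> *\<^sub>R e \<longrightarrow> nearly_centred A \<eta> G1 (\<lambda>i. x i - c1) \<longrightarrow> nearly_centred A \<eta> G2 (\<lambda>k. x k - c2) \<longrightarrow>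
       lp2_recovers n G1 G2 x)"
proof -
  define s where "s = sqrt (2 + \<rho>)"
  have s2: "s\<^sup>2 = 2 + \<rho>" using \<rho> by (simp add: s_def)
  have s: "3 / 2 < s"
  proof (rule ccontr)
    assume "\<not> 3 / 2 < s"
    moreover have "0 \<le> s" using \<rho> by (simp add: s_def)
    ultimately have "s\<^sup>2 \<le> (3 / 2)\<^sup>2" by (intro power_mono) auto
    then show False using s2 \<rho> by (simp add: power2_eq_square)
  qed
  define u where "u = s - 1"
  have u: "0 < u" "\<rho> = u\<^sup>2 + 2 * u - 1" "s = 1 + u"
    using s s2 by (simp_all add: u_def power2_eq_square algebra_simps)
  define D \<Delta>0 \<gamma> where "D = 4 / u" and "\<Delta>0 = 1 + s" and "\<gamma> = (\<Delta> - \<Delta>0) * (\<Delta> + \<Delta>0 - 4) / (1 + \<rho>)"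
  have \<Delta>0: "\<Delta>0 < \<Delta>" "4 < \<Delta> + \<Delta>0" using \<Delta> s by (simp_all add: \<Delta>0_def s_def)
  have D: "0 < D" using u by (simp add: D_def)
  have "2 \<le> u\<^sup>2 + 2 * u" using \<rho> u by simp
  then have D2: "D\<^sup>2 \<le> 4 * D + 8" using u(1) by (simp add: D_def field_simps power2_eq_square)
  have \<rho>D: "\<rho> * D = 16 / D + 8 - D"
    unfolding u(2) D_def using u(1) by (simp add: field_simps power2_eq_square)
  have \<gamma>: "0 < \<gamma>" using \<Delta>0 \<rho> by (simp add: \<gamma>_def)
  obtain U :: "real ^ 'm \<Rightarrow> real ^ 'm \<Rightarrow> real" and \<phi> \<psi> where U: "odd_kernel U" "odd_bounded \<phi>" "odd_bounded \<psi>"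
    "\<And>y z. norm y = 1 \<Longrightarrow> norm z = 1 \<Longrightarrow> - \<gamma> \<le> D * (1 - y \<bullet> e) + U y z + \<phi> z"
    "\<And>y z. norm y = 1 \<Longrightarrow> norm z = 1 \<Longrightarrow> 0 \<le> (16 / D + 8 - D) * (1 + z \<bullet> e) - 4 * (y \<bullet> z) + \<psi> y - U y z"
    using exists_kernel[OF e D D2 \<gamma>] by metis
  show ?thesis
  proof (rule recovers_if_kernel[OF \<rho> D e _ _ \<gamma> _ \<Delta>0 U(1-4)])
    show "(1 + \<rho>) * D = 4 * \<Delta>0"
      unfolding u(2) D_def \<Delta>0_def u(3) using u(1) by (simp add: field_simps power2_eq_square)
    show "\<Delta>0\<^sup>2 = 2 * \<Delta>0 + 1 + \<rho>"
      using s2 by (simp add: \<Delta>0_def power2_eq_square algebra_simps)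
    show "(1 + \<rho>) * \<gamma> \<le> (\<Delta> - \<Delta>0) * (\<Delta> + \<Delta>0 - 4)" using \<rho> by (simp add: \<gamma>_def)
    show "0 \<le> \<rho> * D * (1 + z \<bullet> e) - 4 * (y \<bullet> z) + \<psi> y - U y z" if "norm y = 1" "norm z = 1" for y z
      using U(5)[OF that] by (simp add: \<rho>D)
  qed
qed

section \<open>Concentration of the sample averages\<close>

lemma lborel_distr_uminus_euclidean: "distr lborel borel uminus = (lborel :: 'a :: euclidean_space measure)"
  by (subst lborel_affine[of "-1" 0]) (auto simp: density_1 one_ennreal_def[symmetric])

lemma uniform_ball_uminus:
  "distr (uniform_measure lborel (ball 0 1)) borel uminus = uniform_measure lborel (ball (0 :: 'a :: euclidean_space) 1)"
proof (rule measure_eqI)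
  fix A :: "'a set" assume "A \<in> sets (distr (uniform_measure lborel (ball 0 1)) borel uminus)"
  then have A [measurable]: "A \<in> sets borel" by simp
  have "emeasure lborel (ball 0 1 \<inter> uminus -` A) = emeasure (distr lborel borel uminus) (ball 0 1 \<inter> A)"
    by (subst emeasure_distr) (auto intro!: arg_cong[where f = "emeasure lborel"])
  then show "emeasure (distr (uniform_measure lborel (ball 0 1)) borel uminus) A
      = emeasure (uniform_measure lborel (ball (0 :: 'a) 1)) A"
    using measurable_sets[of uminus borel borel A]
    by (simp add: emeasure_distr lborel_distr_uminus_euclidean)
qed simp

lemma expectation_odd_uniform_sphere:
  fixes h :: "real ^ 'm \<Rightarrow> real"
  assumes [measurable]: "h \<in> borel_measurable borel" and odd: "\<And>y. h (- y) = - h y"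
  shows "(\<integral>x. h (x - c) \<partial>uniform_sphere c) = 0"
proof -
  let ?U = "uniform_measure lborel (ball (0 :: real ^ 'm) 1)"
  have [measurable]: "(\<lambda>y. h (sgn y)) \<in> borel_measurable borel"
    using measurable_compose[OF measurable_shift_sgn[of 0], of h borel] by simp
  have eq: "(\<integral>x. h (x - c) \<partial>uniform_sphere c) = (\<integral>y. h (sgn y) \<partial>?U)"
    unfolding uniform_sphere_def by (subst integral_distr) auto
  have "(\<integral>y. h (sgn y) \<partial>?U) = (\<integral>y. h (sgn y) \<partial>distr ?U borel uminus)"
    by (simp add: uniform_ball_uminus)
  also have "\<dots> = (\<integral>y. - h (sgn y) \<partial>?U)"
    by (subst integral_distr) (auto simp: sgn_minus odd)
  finally show ?thesis by (simp add: eq)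
qed

lemma sphere_average_concentration:
  fixes h :: "real ^ 'm \<Rightarrow> real" and ctr :: "nat \<Rightarrow> real ^ 'm"
  assumes [measurable]: "h \<in> borel_measurable borel" and odd: "\<And>y. h (- y) = - h y"
    and bounded: "\<And>y. norm y = 1 \<Longrightarrow> \<bar>h y\<bar> \<le> 1"
    and I: "finite I" "S \<subseteq> I" "S \<noteq> {}" and ctr: "\<And>i. i \<in> S \<Longrightarrow> ctr i = c" and \<eta>: "0 \<le> \<eta>"
  defines "M \<equiv> Pi\<^sub>M I (\<lambda>i. uniform_sphere (ctr i))"
  shows "measure M {x \<in> space M. \<eta> \<le> \<bar>avg S (\<lambda>i. h (x i - c))\<bar>} \<le> 2 * exp (- (real (card S) * \<eta>\<^sup>2 / 2))"
proof -
  have ps: "prob_space (uniform_sphere (ctr i))" for i by (rule prob_space_uniform_sphere)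
  interpret M: prob_space M unfolding M_def by (intro prob_space_PiM ps)
  have comp: "distr M (uniform_sphere (ctr i)) (\<lambda>x. x i) = uniform_sphere (ctr i)" if "i \<in> I" for i
    unfolding M_def using that by (intro distr_PiM_component ps)
  have mcomp [measurable]: "(\<lambda>x. x i) \<in> borel_measurable M" if "i \<in> I" for i
  proof -
    have "(\<lambda>x. x i) \<in> measurable M (uniform_sphere (ctr i))" unfolding M_def using that by measurable
    then show ?thesis by (simp cong: measurable_cong_sets)
  qed
  have "distr M (Pi\<^sub>M I (\<lambda>i. uniform_sphere (ctr i))) (\<lambda>x. \<lambda>i\<in>I. x i) = distr M M (\<lambda>x. x)"
    by (rule distr_cong) (auto simp: M_def space_PiM PiE_def extensional_restrict)
  also have "\<dots> = Pi\<^sub>M I (\<lambda>i. distr M (uniform_sphere (ctr i)) (\<lambda>x. x i))"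
    by (simp add: distr_id M_def) (intro PiM_cong refl, simp add: comp[unfolded M_def])
  finally have "M.indep_vars (\<lambda>i. uniform_sphere (ctr i)) (\<lambda>i x. x i) I"
    using I by (subst M.indep_vars_iff_distr_eq_PiM') (auto simp: M_def)
  then have "M.indep_vars (\<lambda>i. uniform_sphere (ctr i)) (\<lambda>i x. x i) S"
    by (rule M.indep_vars_subset) (use I in auto)
  then have indep: "M.indep_vars (\<lambda>_. borel) (\<lambda>i x. h (x i - c)) S"
    by (rule M.indep_vars_compose2[where Y = "\<lambda>_ y. h (y - c)"]) (simp cong: measurable_cong_sets)
  have range: "AE x in M. h (x i - c) \<in> {-1..1}" if "i \<in> S" for i
  proof -
    have "AE y in uniform_sphere (ctr i). h (y - c) \<in> {-1..1}"
      using AE_uniform_sphere[of "ctr i"]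
    proof eventually_elim
      case (elim y)
      then have "norm (y - c) = 1" using ctr[OF that] by (simp add: dist_norm norm_minus_commute)
      then show ?case using bounded[of "y - c"] by (simp add: abs_le_iff)
    qed
    then show ?thesis unfolding M_def using that I by (intro AE_PiM_component ps) auto
  qed
  have mean: "M.expectation (\<lambda>x. h (x i - c)) = 0" if "i \<in> S" for i
  proof -
    have i: "i \<in> I" using that I by auto
    have "M.expectation (\<lambda>x. h (x i - c)) = (\<integral>y. h (y - c) \<partial>distr M (uniform_sphere (ctr i)) (\<lambda>x. x i))"
      using i by (subst integral_distr) (auto cong: measurable_cong_sets)
    also have "\<dots> = 0" using comp[OF i] ctr[OF that] expectation_odd_uniform_sphere[of h c] odd by simp
    finally show ?thesis .
  qed
  have S: "finite S" using I finite_subset by auto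
  have card: "real (card S) > 0" using S I by (simp add: card_gt_0_iff)
  interpret H: Hoeffding_ineq M S "\<lambda>i x. h (x i - c)" "\<lambda>_. -1" "\<lambda>_. 1" 0
    by unfold_locales (use S indep range mean in auto)
  have "{x \<in> space M. \<eta> \<le> \<bar>avg S (\<lambda>i. h (x i - c))\<bar>} = {x \<in> space M. card S * \<eta> \<le> \<bar>(\<Sum>i\<in>S. h (x i - c)) - 0\<bar>}"
    using card by (auto simp: avg_def field_simps)
  also have "M.prob \<dots> \<le> 2 * exp (- 2 * (card S * \<eta>)\<^sup>2 / (\<Sum>i\<in>S. (1 - (-1))\<^sup>2))"
    using card \<eta> by (intro H.Hoeffding_ineq_abs_ge) auto
  also have "- 2 * (card S * \<eta>)\<^sup>2 / (\<Sum>i\<in>S. (1 - (-1::real))\<^sup>2) = - (real (card S) * \<eta>\<^sup>2 / 2)"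
    using card by (simp add: power2_eq_square field_simps)
  finally show ?thesis .
qed

text \<open>
  The rate must not depend on the sample, because the clusters grow while \<open>\<alpha>\<close> and \<open>\<eta>\<close> stay fixed.
\<close>

definition concentration_rate :: "real \<Rightarrow> (real ^ 'm \<Rightarrow> real) \<Rightarrow> real \<Rightarrow> bool" where
  "concentration_rate \<eta> \<alpha> q \<longleftrightarrow> 0 < q \<and>
    (\<forall>I S c (ctr :: nat \<Rightarrow> real ^ 'm). finite I \<longrightarrow> S \<subseteq> I \<longrightarrow> S \<noteq> {} \<longrightarrow> (\<forall>i\<in>S. ctr i = c) \<longrightarrow>
      measure (Pi\<^sub>M I (\<lambda>i. uniform_sphere (ctr i)))
        {x \<in> space (Pi\<^sub>M I (\<lambda>i. uniform_sphere (ctr i))). \<eta> \<le> \<bar>avg S (\<lambda>i. \<alpha> (x i - c))\<bar>}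
      \<le> 2 * exp (- (q * real (card S))))"

lemma odd_bounded_concentration:
  fixes \<alpha> :: "real ^ 'm \<Rightarrow> real"
  assumes \<alpha>: "odd_bounded \<alpha>" and \<eta>: "0 < \<eta>"
  shows "\<exists>q. concentration_rate \<eta> \<alpha> q"
proof -
  obtain C0 where C0: "\<And>y. norm y = 1 \<Longrightarrow> \<bar>\<alpha> y\<bar> \<le> C0" using \<alpha> by (auto simp: odd_bounded_def)
  define C where "C = \<bar>C0\<bar> + 1"
  have C: "C > 0" by (simp add: C_def)
  have [measurable]: "\<alpha> \<in> borel_measurable borel" using \<alpha> by (simp add: odd_bounded_def)
  have 1: "\<bar>\<alpha> y / C\<bar> \<le> 1" if "norm y = 1" for y
    using C0[OF that] C by (simp add: C_def abs_divide)
  have "measure (Pi\<^sub>M I (\<lambda>i. uniform_sphere (ctr i)))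
      {x \<in> space (Pi\<^sub>M I (\<lambda>i. uniform_sphere (ctr i))). \<eta> \<le> \<bar>avg S (\<lambda>i. \<alpha> (x i - c))\<bar>}
      \<le> 2 * exp (- ((\<eta> / C)\<^sup>2 / 2 * real (card S)))"
    if "finite I" "S \<subseteq> I" "S \<noteq> {}" "\<forall>i\<in>S. ctr i = c" for I S c and ctr :: "nat \<Rightarrow> real ^ 'm"
  proof -
    have "measure (Pi\<^sub>M I (\<lambda>i. uniform_sphere (ctr i)))
      {x \<in> space (Pi\<^sub>M I (\<lambda>i. uniform_sphere (ctr i))). \<eta> / C \<le> \<bar>avg S (\<lambda>i. \<alpha> (x i - c) / C)\<bar>}
      \<le> 2 * exp (- (real (card S) * (\<eta> / C)\<^sup>2 / 2))"
      using that \<alpha> \<eta> C 1 by (intro sphere_average_concentration[of "\<lambda>y. \<alpha> y / C"]) (auto simp: odd_bounded_def)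
    moreover have "avg S (\<lambda>i. f i / C) = avg S f / C" for f
      using avg_multc[of S f "1 / C"] by simp
    ultimately show ?thesis using C by (simp add: abs_divide divide_le_cancel mult.commute)
  qed
  moreover have "0 < (\<eta> / C)\<^sup>2 / 2" using \<eta> C by simp
  ultimately have "concentration_rate \<eta> \<alpha> ((\<eta> / C)\<^sup>2 / 2)" by (simp only: concentration_rate_def) blast
  then show ?thesis ..
qed

text \<open>
  Almost surely all points lie on their spheres, so recovery can fail only if one of the finitely many
  test functions has a large sample average.
\<close>

lemma recovery_probability_bound:
  fixes c1 c2 :: "real ^ 'm" and A :: "(real ^ 'm \<Rightarrow> real) set"
  assumes part: "planted_partition n G1 G2"
    and A: "finite A" "\<And>\<alpha>. \<alpha> \<in> A \<Longrightarrow> odd_bounded \<alpha>"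
    and recovers: "\<And>x. nearly_centred A \<eta> G1 (\<lambda>i. x i - c1) \<Longrightarrow> nearly_centred A \<eta> G2 (\<lambda>k. x k - c2) \<Longrightarrow> lp2_recovers n G1 G2 x"
    and conc: "\<And>\<alpha>. \<alpha> \<in> A \<Longrightarrow> concentration_rate \<eta> \<alpha> (q \<alpha>)"
  defines "M \<equiv> stochastic_sphere_model c1 c2 G1 G2"
  shows "1 - (\<Sum>\<alpha>\<in>A. 2 * exp (- (q \<alpha> * real (card G1))) + 2 * exp (- (q \<alpha> * real (card G2))))
      \<le> measure M {x \<in> space M. lp2_recovers n G1 G2 x}" and "prob_space M"
proof -
  have Un: "{1..n} = G1 \<union> G2" and disj: "G1 \<inter> G2 = {}" and ne: "G1 \<noteq> {}" "G2 \<noteq> {}"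
    using part by (auto simp: planted_partition_def)
  have fin: "finite (G1 \<union> G2)" by (simp flip: Un)
  define ctr where "ctr i = (if i \<in> G1 then c1 else c2)" for i
  have M: "M = Pi\<^sub>M (G1 \<union> G2) (\<lambda>i. uniform_sphere (ctr i))"
    by (simp add: M_def stochastic_sphere_model_def ctr_def)
  have ctr: "\<forall>i\<in>G1. ctr i = c1" "\<forall>i\<in>G2. ctr i = c2" using disj by (auto simp: ctr_def)
  show prob: "prob_space M" unfolding M by (intro prob_space_PiM prob_space_uniform_sphere)
  interpret M: prob_space M by (rule prob)
  define R where "R = {x \<in> space M. lp2_recovers n G1 G2 x}"
  define B where "B \<alpha> S c = {x \<in> space M. \<eta> \<le> \<bar>avg S (\<lambda>i. \<alpha> (x i - c))\<bar>}" for \<alpha> S c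
  have R [measurable]: "R \<in> sets M" unfolding R_def M_def by (rule sets_lp2_recovers[OF part])
  have B: "B \<alpha> S c \<in> sets M" if "\<alpha> \<in> A" "S \<subseteq> G1 \<union> G2" for \<alpha> S c
  proof -
    have [measurable]: "\<alpha> \<in> borel_measurable borel" using A(2)[OF that(1)] by (simp add: odd_bounded_def)
    have "(\<lambda>x. x i) \<in> borel_measurable M" if "i \<in> G1 \<union> G2" for i
      using measurable_component_singleton[OF that, of "\<lambda>i. uniform_sphere (ctr i)"]
      unfolding M by (simp cong: measurable_cong_sets)
    then have [measurable]: "(\<lambda>x. x i) \<in> borel_measurable M" if "i \<in> S" for i using that \<open>S \<subseteq> G1 \<union> G2\<close> by blast
    show ?thesis unfolding B_def avg_def by measurable
  qed
  have "AE x in M. \<forall>i\<in>G1 \<union> G2. x i \<in> sphere (ctr i) 1"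
    unfolding M using fin
    by (intro AE_finite_allI AE_PiM_component prob_space_uniform_sphere AE_uniform_sphere)
  then have all: "AE x in M. x \<in> R \<union> (\<Union>\<alpha>\<in>A. B \<alpha> G1 c1 \<union> B \<alpha> G2 c2)"
    using AE_space
  proof eventually_elim
    case (elim x)
    show ?case
    proof (rule ccontr)
      assume x: "x \<notin> R \<union> (\<Union>\<alpha>\<in>A. B \<alpha> G1 c1 \<union> B \<alpha> G2 c2)"
      have "norm (x i - ctr i) = 1" if "i \<in> G1 \<union> G2" for i
        using elim(1) that by (auto simp: dist_norm norm_minus_commute)
      then have "nearly_centred A \<eta> G1 (\<lambda>i. x i - c1)" "nearly_centred A \<eta> G2 (\<lambda>k. x k - c2)"
        using x elim(2) ctr by (fastforce simp: nearly_centred_def B_def)+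
      then have "lp2_recovers n G1 G2 x" by (rule recovers)
      then show False using x elim(2) by (simp add: R_def)
    qed
  qed
  have "R \<union> (\<Union>\<alpha>\<in>A. B \<alpha> G1 c1 \<union> B \<alpha> G2 c2) \<in> sets M"
    using A B by (intro sets.Un sets.finite_UN R) auto
  from sym[OF iffD2[OF M.prob_eq_1[OF this] all]] have "1 = measure M (R \<union> (\<Union>\<alpha>\<in>A. B \<alpha> G1 c1 \<union> B \<alpha> G2 c2))"
    .
  also have "\<dots> \<le> measure M R + measure M (\<Union>\<alpha>\<in>A. B \<alpha> G1 c1 \<union> B \<alpha> G2 c2)"
    using A B by (intro measure_Un_le) auto
  also have "measure M (\<Union>\<alpha>\<in>A. B \<alpha> G1 c1 \<union> B \<alpha> G2 c2) \<le> (\<Sum>\<alpha>\<in>A. measure M (B \<alpha> G1 c1 \<union> B \<alpha> G2 c2))"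
    using A B by (intro M.finite_measure_subadditive_finite) auto
  also have "\<dots> \<le> (\<Sum>\<alpha>\<in>A. 2 * exp (- (q \<alpha> * real (card G1))) + 2 * exp (- (q \<alpha> * real (card G2))))"
  proof (intro sum_mono)
    fix \<alpha> assume \<alpha>: "\<alpha> \<in> A"
    have "measure M (B \<alpha> G1 c1 \<union> B \<alpha> G2 c2) \<le> measure M (B \<alpha> G1 c1) + measure M (B \<alpha> G2 c2)"
      using B \<alpha> by (intro measure_Un_le) auto
    also have "\<dots> \<le> 2 * exp (- (q \<alpha> * real (card G1))) + 2 * exp (- (q \<alpha> * real (card G2)))"
      using conc[OF \<alpha>] fin ne ctr unfolding B_def M concentration_rate_def by (intro add_mono) blast+
    finally show "measure M (B \<alpha> G1 c1 \<union> B \<alpha> G2 c2) \<le> 2 * exp (- (q \<alpha> * real (card G1))) + 2 * exp (- (q \<alpha> * real (card G2)))" .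
  qed
  finally show "1 - (\<Sum>\<alpha>\<in>A. 2 * exp (- (q \<alpha> * real (card G1))) + 2 * exp (- (q \<alpha> * real (card G2))))
      \<le> measure M {x \<in> space M. lp2_recovers n G1 G2 x}" by (simp add: R_def)
qed

theorem proposition4:
  fixes c1 c2 :: "real ^ 'm"
    and \<Delta> r1 :: real
    and n :: "nat \<Rightarrow> nat"
    and \<Gamma>1 \<Gamma>2 :: "nat \<Rightarrow> nat set"
  assumes "dist c1 c2 = \<Delta>"
    and "r1 \<in> {0<..1}"
    and "filterlim n at_top sequentially"
    and "\<And>k. planted_partition (n k) (\<Gamma>1 k) (\<Gamma>2 k)"
    and "\<And>k. card (\<Gamma>1 k) \<le> card (\<Gamma>2 k)"
    and "\<And>k. r1 = 2 * real (card (\<Gamma>1 k)) / (real (card (\<Gamma>1 k)) + real (card (\<Gamma>2 k)))"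
    and "\<Delta> > 1 + sqrt (1 + 2 / r1)"
  shows "(\<lambda>k. measure (stochastic_sphere_model c1 c2 (\<Gamma>1 k) (\<Gamma>2 k))
            {x \<in> space (stochastic_sphere_model c1 c2 (\<Gamma>1 k) (\<Gamma>2 k)).
               lp2_recovers (n k) (\<Gamma>1 k) (\<Gamma>2 k) x}) \<longlonglongrightarrow> 1"
proof -
  have r1: "0 < r1" "r1 \<le> 1" using assms(2) by auto
  define \<rho> where "\<rho> = 2 / r1 - 1"
  have \<rho>: "1 \<le> \<rho>" using r1 by (simp add: \<rho>_def field_simps)
  have cards: "real (card (\<Gamma>1 k)) = r1 / 2 * real (n k)" "real (card (\<Gamma>2 k)) = \<rho> * real (card (\<Gamma>1 k))" for k
  proof -
    have Un: "{1..n k} = \<Gamma>1 k \<union> \<Gamma>2 k" and disj: "\<Gamma>1 k \<inter> \<Gamma>2 k = {}" and ne: "\<Gamma>1 k \<noteq> {}"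
      using assms(4)[of k] by (auto simp: planted_partition_def)
    have "finite (\<Gamma>1 k \<union> \<Gamma>2 k)" by (simp flip: Un)
    then have fin: "finite (\<Gamma>1 k)" "finite (\<Gamma>2 k)" by auto
    have pos: "real (card (\<Gamma>1 k)) > 0" using fin ne by (simp add: card_gt_0_iff)
    have "n k = card {1..n k}" by simp
    also have "\<dots> = card (\<Gamma>1 k) + card (\<Gamma>2 k)" unfolding Un by (rule card_Un_disjoint[OF fin disj])
    finally have n: "real (n k) = real (card (\<Gamma>1 k)) + real (card (\<Gamma>2 k))" by simp
    then have "r1 = 2 * real (card (\<Gamma>1 k)) / real (n k)" using assms(6)[of k] by simp
    then show *: "real (card (\<Gamma>1 k)) = r1 / 2 * real (n k)" using n pos by (simp add: field_simps)
    have "real (card (\<Gamma>2 k)) = 2 / r1 * real (card (\<Gamma>1 k)) - real (card (\<Gamma>1 k))"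
      using n r1 unfolding * by simp
    then show "real (card (\<Gamma>2 k)) = \<rho> * real (card (\<Gamma>1 k))" by (simp add: \<rho>_def algebra_simps)
  qed
  have \<Delta>: "1 + sqrt (2 + \<rho>) < \<Delta>" using assms(7) by (simp add: \<rho>_def add.commute)
  moreover have "0 \<le> sqrt (2 + \<rho>)" using \<rho> by simp
  ultimately have \<Delta>pos: "0 < \<Delta>" by linarith
  define e where "e = (1 / \<Delta>) *\<^sub>R (c2 - c1)"
  have e: "norm e = 1" "c2 - c1 = \<Delta> *\<^sub>R e"
    using assms(1) \<Delta>pos by (simp_all add: e_def dist_norm norm_minus_commute)
  obtain A \<eta> where A: "finite A" "\<forall>\<alpha>\<in>A. odd_bounded \<alpha>" "0 < \<eta>"
    and rec: "\<forall>n G1 G2 c1 c2 x. planted_partition n G1 G2 \<longrightarrow> 3 \<le> n \<longrightarrow> real (card G2) = \<rho> * real (card G1) \<longrightarrow>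
       c2 - c1 = \<Delta> *\<^sub>R e \<longrightarrow> nearly_centred A \<eta> G1 (\<lambda>i. x i - c1) \<longrightarrow> nearly_centred A \<eta> G2 (\<lambda>k. x k - c2) \<longrightarrow>
       lp2_recovers n G1 G2 x"
    using recovers_if_nearly_centred[OF \<rho> e(1) \<Delta>] by (elim exE conjE) (rule that)
  have "\<forall>\<alpha>\<in>A. \<exists>q. concentration_rate \<eta> \<alpha> q"
    using odd_bounded_concentration A(2,3) by blast
  from bchoice[OF this] obtain q where conc: "\<And>\<alpha>. \<alpha> \<in> A \<Longrightarrow> concentration_rate \<eta> \<alpha> (q \<alpha>)"
    by blast
  then have q: "0 < q \<alpha>" if "\<alpha> \<in> A" for \<alpha> using that by (simp add: concentration_rate_def)
  define err where "err k = (\<Sum>\<alpha>\<in>A. 2 * exp (- (q \<alpha> * real (card (\<Gamma>1 k)))) + 2 * exp (- (q \<alpha> * real (card (\<Gamma>2 k)))))" for k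
  have n: "filterlim (\<lambda>k. real (n k)) at_top sequentially"
    by (rule filterlim_compose[OF filterlim_real_sequentially assms(3)])
  have "((\<lambda>k. exp (- (p * real (n k)))) \<longlongrightarrow> 0) sequentially" if "p > 0" for p
    using that by (intro filterlim_compose[OF exp_at_bot] filterlim_compose[OF filterlim_uminus_at_bot_at_top]
        filterlim_tendsto_pos_mult_at_top[OF tendsto_const _ n])
  then have lim: "((\<lambda>k. exp (- (p * (p' * real (n k))))) \<longlongrightarrow> 0) sequentially" if "p > 0" "p' > 0" for p p'
    using that by (simp add: mult.assoc[symmetric])
  have "(err \<longlongrightarrow> (\<Sum>\<alpha>\<in>A. 2 * 0 + 2 * 0)) sequentially"
    unfolding err_def
  proof (intro tendsto_sum tendsto_add tendsto_mult tendsto_const)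
    fix \<alpha> assume \<alpha>: "\<alpha> \<in> A"
    show "(\<lambda>k. exp (- (q \<alpha> * real (card (\<Gamma>1 k))))) \<longlonglongrightarrow> 0"
      unfolding cards(1) using q[OF \<alpha>] r1 by (intro lim) auto
    have card2: "real (card (\<Gamma>2 k)) = \<rho> * (r1 / 2) * real (n k)" for k using cards[of k] by simp
    show "(\<lambda>k. exp (- (q \<alpha> * real (card (\<Gamma>2 k))))) \<longlonglongrightarrow> 0"
      unfolding card2 using q[OF \<alpha>] r1 \<rho> by (intro lim) auto
  qed
  then have "((\<lambda>k. 1 - err k) \<longlongrightarrow> 1 - 0) sequentially"
    by (intro tendsto_diff tendsto_const) simp
  then have lower: "(\<lambda>k. 1 - err k) \<longlonglongrightarrow> 1" by simp
  have large: "eventually (\<lambda>k. 3 \<le> n k) sequentially"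
    using assms(3) by (auto simp: filterlim_at_top)
  show ?thesis
  proof (rule tendsto_sandwich[OF _ _ lower tendsto_const])
    show "\<forall>\<^sub>F k in sequentially. 1 - err k \<le> measure (stochastic_sphere_model c1 c2 (\<Gamma>1 k) (\<Gamma>2 k))
        {x \<in> space (stochastic_sphere_model c1 c2 (\<Gamma>1 k) (\<Gamma>2 k)). lp2_recovers (n k) (\<Gamma>1 k) (\<Gamma>2 k) x}"
      using large
    proof eventually_elim
      case (elim k)
      show ?case
        unfolding err_def
        by (rule recovery_probability_bound(1)[OF assms(4) A(1) A(2)[rule_format]
              rec[rule_format, OF assms(4) elim cards(2) e(2)] conc])
    qed
    show "\<forall>\<^sub>F k in sequentially. measure (stochastic_sphere_model c1 c2 (\<Gamma>1 k) (\<Gamma>2 k))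
        {x \<in> space (stochastic_sphere_model c1 c2 (\<Gamma>1 k) (\<Gamma>2 k)). lp2_recovers (n k) (\<Gamma>1 k) (\<Gamma>2 k) x} \<le> 1"
      unfolding stochastic_sphere_model_def
      by (intro always_eventually allI prob_space.prob_le_1 prob_space_PiM prob_space_uniform_sphere)
  qed
qed

end
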